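(* Let $k\geq 4$ be an integer, let $n$ be a positive integer, and let $d$ be a real number with $$d\geq \max\bigl(20\sqrt{k}\,\log k\cdot n^{1/k},\ (2k)^{8k}\bigr).$$ If $G$ is a bipartite $n$-vertex graph of minimum degree at least $2d+5k^2$, then $G$ contains a cycle of length $2k$.
   Context: Graphs are finite and simple. "Contains" means as a (not necessarily induced) subgraph. $\log$ is the natural logarithm. *)

theory Defs
  imports Complex_Main "Graph_Theory.Arc_Walk"
begin

text \<open>
  The locale \<^locale>\<open>graph\<close> describes finite simple graphs: each undirected edge is
  represented by a pair of opposite arcs, with no loops and no parallel arcs. Hence
  \<^const>\<open>out_degree\<close> is the usual vertex degree. The library predicate
  \<^term>\<open>pre_digraph.cycle\<close> holds of a closed arc walk without repeated vertices; it admits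
  the degenerate walk \<open>u, v, u\<close> of length 2, but from length 3 on it is the usual notion of
  a cycle, and the number of arcs is the length of the cycle.
\<close>

definition bipartite :: "('a, 'b) pre_digraph \<Rightarrow> bool" where
  "bipartite G \<longleftrightarrow> (\<exists>A B. verts G = A \<union> B \<and> A \<inter> B = {} \<and>
     (\<forall>(u, v) \<in> arcs_ends G. (u \<in> A \<and> v \<in> B) \<or> (u \<in> B \<and> v \<in> A)))"

text \<open>Meaningful only for a finite, nonempty vertex set.\<close>

definition min_degree :: "('a, 'b) pre_digraph \<Rightarrow> nat" where
  "min_degree G = Min (out_degree G ` verts G)"

end

theory Submission
  imports Defs
begin

text \<open>
  Suppose that there is no cycle of length \<open>2 k\<close> and explore the graph by breadth-first search, with
  levels \<open>L 0, L 1, \<dots>\<close>. A theta graph (a cycle of length at least \<open>2 k\<close> with a chord) contains paths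
  of every even length below \<open>2 k\<close> between any two complementary parts of a colour class. If it lies
  in three consecutive levels, and each of its vertices in the middle level has a neighbour outside
  of it in the lower level, then completing such a path through the search tree gives a cycle of
  length \<open>2 k\<close>.

  Hence two consecutive levels span few edges. Three consecutive levels of sizes \<open>a, b, c\<close> satisfy
  more: restrict the middle level to the vertices with about \<open>2 m\<close> neighbours below, where \<open>m\<close> is
  chosen by a dyadic pigeonhole principle at the cost of a factor \<open>ln k\<close>. If \<open>c / a\<close> were smaller than
  \<open>d\<^sup>2 / (400 k ln\<^sup>2 k)\<close>, then the upper two levels would contain many disjoint paths with about
  \<open>2 k / m\<close> vertices, and a longest chain of such paths linked through vertices of the lower level would
  close up to a theta graph. So \<open>L k\<close> has at least \<open>n\<close> vertices, a contradiction.
\<close>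

section \<open>Dense bipartite graphs and theta graphs\<close>

text \<open>Two consecutive levels alone give growth by \<open>d / k\<close> per step, that is
  \<open>d^2 / k^2\<close> over two steps; a third level saves almost a whole factor
  \<open>k\<close>. When middle vertices have about \<open>2 m\<close> neighbours below, chords that
  jump over whole blocks of a chain make paths of about \<open>2 k / m\<close> vertices long enough,
  so the upper two levels need average degree of order \<open>k / m\<close> only, instead of
  \<open>k\<close>. If they are not that dense, then \<open>c\<close> is at least of order
  \<open>d m |U| / k\<close> for the chosen middle set \<open>U\<close>, and counting edges
  downwards gives \<open>|U|\<close> at least of order \<open>d a / (m ln k)\<close>. The unknown
  \<open>m\<close> cancels in the product.

  The obstacle is the demand for free lower neighbours. A theta graph in two levels does not meet
  the level below, so the demand is met automatically; a theta graph in three levels could swallow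
  all lower neighbours of a middle vertex. Therefore the lower level is split beforehand into a part
  that the theta graph may use and a rest reserved for leaving it, such that a quarter of the middle
  vertices keep \<open>m\<close> neighbours in the first part and at least one in the
  second.\<close>

lemma multigraph_core:
  fixes p :: "'e \<Rightarrow> 'x" and q :: "'e \<Rightarrow> 'y" and F :: "'e set"
  assumes "finite F" and "a * card (p ` F) + b * card (q ` F) < card F"
  shows "\<exists>F'\<subseteq>F. F' \<noteq> {} \<and> (\<forall>x\<in>p ` F'. a < card {e\<in>F'. p e = x}) \<and> (\<forall>y\<in>q ` F'. b < card {e\<in>F'. q e = y})"
  using assms
proof (induction "card F" arbitrary: F rule: less_induct)
  case less
  \<comment> \<open>Peeling: deleting a vertex of degree at most \<open>a\<close> (or
    \<open>b\<close>) lowers the weighted vertex count by at least \<open>a\<close> (or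
    \<open>b\<close>) and the edge count by at most as much, so the strict inequality survives.
    \<open>D\<close> is the set of deleted edges.\<close>
  have shrink: "\<exists>F'\<subseteq>F. F' \<noteq> {} \<and> (\<forall>x\<in>p ` F'. a < card {e\<in>F'. p e = x}) \<and> (\<forall>y\<in>q ` F'. b < card {e\<in>F'. q e = y})"
    if D: "D \<subseteq> F" "D \<noteq> {}" and le: "a * card (p ` (F - D)) + b * card (q ` (F - D)) + card D \<le> a * card (p ` F) + b * card (q ` F)" for D
  proof -
    have fin: "finite D" using D less.prems finite_subset by blast
    have c: "card (F - D) = card F - card D" "card D \<le> card F" "0 < card D"
      using D fin less.prems by (auto simp: card_Diff_subset card_mono card_gt_0_iff)
    have "a * card (p ` (F - D)) + b * card (q ` (F - D)) < card (F - D)"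
      using c le less.prems(2) by linarith
    then have "\<exists>F'\<subseteq>F - D. F' \<noteq> {} \<and> (\<forall>x\<in>p ` F'. a < card {e\<in>F'. p e = x}) \<and> (\<forall>y\<in>q ` F'. b < card {e\<in>F'. q e = y})"
      using less.hyps[of "F - D"] c less.prems(1) by auto
    then show ?thesis by blast
  qed
  show ?case
  proof (cases "(\<forall>x\<in>p ` F. a < card {e\<in>F. p e = x}) \<and> (\<forall>y\<in>q ` F. b < card {e\<in>F. q e = y})")
    case True
    then show ?thesis using less.prems(2) by (intro exI[of _ F]) auto
  next
    case False
    then consider x where "x \<in> p ` F" "card {e\<in>F. p e = x} \<le> a" | y where "y \<in> q ` F" "card {e\<in>F. q e = y} \<le> b"
      by (meson not_le)
    then show ?thesis
    proof cases
      case 1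
      let ?D = "{e\<in>F. p e = x}"
      have "p ` (F - ?D) = p ` F - {x}" by auto
      then have "card (p ` F) = Suc (card (p ` (F - ?D)))"
        using 1 less.prems(1) card.remove[of "p ` F" x] by simp
      then have "a * card (p ` F) = a + a * card (p ` (F - ?D))" by simp
      moreover have "b * card (q ` (F - ?D)) \<le> b * card (q ` F)"
        using less.prems(1) by (intro mult_le_mono card_mono image_mono) auto
      ultimately have "a * card (p ` (F - ?D)) + b * card (q ` (F - ?D)) + card ?D \<le> a * card (p ` F) + b * card (q ` F)"
        using 1 by linarith
      then show ?thesis using 1 by (intro shrink[of ?D]) auto
    next
      case 2
      let ?D = "{e\<in>F. q e = y}"
      have "q ` (F - ?D) = q ` F - {y}" by auto
      then have "card (q ` F) = Suc (card (q ` (F - ?D)))"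
        using 2 less.prems(1) card.remove[of "q ` F" y] by simp
      then have "b * card (q ` F) = b + b * card (q ` (F - ?D))" by simp
      moreover have "a * card (p ` (F - ?D)) \<le> a * card (p ` F)"
        using less.prems(1) by (intro mult_le_mono card_mono image_mono) auto
      ultimately have "a * card (p ` (F - ?D)) + b * card (q ` (F - ?D)) + card ?D \<le> a * card (p ` F) + b * card (q ` F)"
        using 2 by linarith
      then show ?thesis using 2 by (intro shrink[of ?D]) auto
    qed
  qed
qed

definition edges :: "('a \<Rightarrow> 'a \<Rightarrow> bool) \<Rightarrow> 'a set \<Rightarrow> 'a set \<Rightarrow> ('a \<times> 'a) set" where
  "edges E S T = {(x, y). x \<in> S \<and> y \<in> T \<and> E x y}"

lemma finite_edges [simp]: "finite S \<Longrightarrow> finite T \<Longrightarrow> finite (edges E S T)"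
  by (rule finite_subset[of _ "S \<times> T"]) (auto simp: edges_def)

lemma card_edges_left:
  assumes "finite S" "finite T"
  shows "card (edges E S T) = (\<Sum>x\<in>S. card {y\<in>T. E x y})"
proof -
  have "edges E S T = (SIGMA x:S. {y\<in>T. E x y})" by (auto simp: edges_def)
  then show ?thesis using assms by simp
qed

lemma card_edges_right:
  assumes "finite S" "finite T"
  shows "card (edges E S T) = (\<Sum>y\<in>T. card {x\<in>S. E x y})"
proof -
  have "card (edges E S T) = card (prod.swap ` edges E S T)"
    by (simp add: card_image)
  also have "prod.swap ` edges E S T = (SIGMA y:T. {x\<in>S. E x y})" by (auto simp: edges_def)
  also have "card \<dots> = (\<Sum>y\<in>T. card {x\<in>S. E x y})" using assms by simp
  finally show ?thesis .
qed

lemma edges_core: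
  assumes fin: "finite S" "finite T" and gt: "a * card S + b * card T < card (edges E S T)"
  shows "\<exists>S'\<subseteq>S. \<exists>T'\<subseteq>T. S' \<noteq> {} \<and> T' \<noteq> {} \<and> (\<forall>x\<in>S'. a < card {y\<in>T'. E x y}) \<and> (\<forall>y\<in>T'. b < card {x\<in>S'. E x y})"
proof -
  let ?F = "edges E S T"
  have sub: "fst ` ?F \<subseteq> S" "snd ` ?F \<subseteq> T" by (auto simp: edges_def)
  have "a * card (fst ` ?F) + b * card (snd ` ?F) \<le> a * card S + b * card T"
    using fin sub by (intro add_mono mult_le_mono card_mono) auto
  then obtain F where F: "F \<subseteq> ?F" "F \<noteq> {}" "\<forall>x\<in>fst ` F. a < card {e\<in>F. fst e = x}"
      "\<forall>y\<in>snd ` F. b < card {e\<in>F. snd e = y}"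
    using multigraph_core[of ?F a fst b snd] gt fin by (auto simp del: split_paired_Ex)
  have finF: "finite F" using F(1) fin finite_subset finite_edges by metis
  have "a < card {y\<in>snd ` F. E x y}" if "x \<in> fst ` F" for x
  proof -
    have "a < card {e\<in>F. fst e = x}" using F that by blast
    also have "\<dots> = card (snd ` {e\<in>F. fst e = x})"
      by (rule card_image[symmetric]) (auto simp: inj_on_def)
    also have "\<dots> \<le> card {y\<in>snd ` F. E x y}"
      using F(1) finF by (intro card_mono) (auto simp: edges_def)
    finally show ?thesis .
  qed
  moreover have "b < card {x\<in>fst ` F. E x y}" if "y \<in> snd ` F" for y
  proof -
    have "b < card {e\<in>F. snd e = y}" using F that by blast
    also have "\<dots> = card (fst ` {e\<in>F. snd e = y})"
      by (rule card_image[symmetric]) (auto simp: inj_on_def)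
    also have "\<dots> \<le> card {x\<in>fst ` F. E x y}"
      using F(1) finF by (intro card_mono) (auto simp: edges_def)
    finally show ?thesis .
  qed
  moreover have "fst ` F \<subseteq> S" "snd ` F \<subseteq> T" using F(1) by (auto simp: edges_def)
  ultimately show ?thesis using F(2)
    by (intro exI[of _ "fst ` F"] exI[of _ "snd ` F"] conjI) auto
qed

section \<open>Paths, cycles and chords in a two-coloured graph\<close>

locale bip_adj =
  fixes E :: "'a \<Rightarrow> 'a \<Rightarrow> bool" and col :: "'a \<Rightarrow> bool"
  assumes sym: "E u v \<Longrightarrow> E v u"
    and col: "E u v \<Longrightarrow> col u \<noteq> col v"
begin

definition simple_path :: "'a list \<Rightarrow> bool" where
  "simple_path p \<longleftrightarrow> distinct p \<and> successively E p"

text \<open>The cycle is listed so that the chord leaves its last vertex, the form in which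
  longest-path arguments produce it. The bounds on \<open>j\<close> exclude the two neighbours of
  that vertex on the cycle.\<close>

definition theta :: "nat \<Rightarrow> 'a list \<Rightarrow> bool" where
  "theta k c \<longleftrightarrow> simple_path c \<and> 2 * k \<le> length c \<and> E (last c) (hd c) \<and>
     (\<exists>j>0. j + 2 < length c \<and> E (last c) (c ! j))"

definition has_cycle :: "nat \<Rightarrow> bool" where
  "has_cycle m \<longleftrightarrow> (\<exists>c. simple_path c \<and> length c = m \<and> E (last c) (hd c))"

lemma sym_iff: "E u v \<longleftrightarrow> E v u"
  using sym by blast

lemma simple_path_append:
  "simple_path (p @ q) \<longleftrightarrow> simple_path p \<and> simple_path q \<and> set p \<inter> set q = {} \<and>
     (p = [] \<or> q = [] \<or> E (last p) (hd q))"
  unfolding simple_path_def successively_append_iff by auto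

lemma simple_path_rev: "simple_path (rev p) \<longleftrightarrow> simple_path p"
proof -
  have "(\<lambda>x y. E y x) = E" using sym by (intro ext) blast
  then show ?thesis unfolding simple_path_def successively_rev distinct_rev by metis
qed

lemma simple_path_drop: "simple_path p \<Longrightarrow> simple_path (drop i p)"
  by (metis append_take_drop_id simple_path_append)

lemma simple_path_Nil [simp]: "simple_path []"
  by (simp add: simple_path_def)

lemma simple_path_single [simp]: "simple_path [x]"
  by (simp add: simple_path_def)

lemma simple_path_Cons:
  "simple_path (x # p) \<longleftrightarrow> simple_path p \<and> x \<notin> set p \<and> (p = [] \<or> E x (hd p))"
  using simple_path_append[of "[x]" p] by auto

lemma col_nth:
  assumes "successively E p" "i < length p"
  shows "col (p ! i) = (col (p ! 0) = even i)"
  using assms(2)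
proof (induction i)
  case (Suc i)
  have "E (p ! i) (p ! Suc i)" using assms(1) Suc.prems by (simp add: successively_conv_nth)
  then show ?case using Suc col by fastforce
qed simp

lemma theta_drop:
  assumes p: "simple_path p" and ij: "i < j" "j + 2 < length p"
    and adj: "E (last p) (p ! i)" "E (last p) (p ! j)" and len: "2 * k \<le> length p - i"
  shows "theta k (drop i p)"
  unfolding theta_def
proof (intro conjI exI[of _ "j - i"])
  show "simple_path (drop i p)" using p by (rule simple_path_drop)
qed (use assms in \<open>auto simp: hd_drop_conv_nth\<close>)

text \<open>All neighbours of the last vertex sit at positions of one parity, so \<open>k\<close> of
  them spread over a final stretch of at least \<open>2 k\<close> vertices. The path from the
  earliest neighbour onwards closes to the cycle; a neighbour that is neither this one nor the
  predecessor of the last vertex supplies the chord, and \<open>k \<ge> 3\<close> guarantees that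
  there is one.\<close>

lemma theta_of_fan:
  assumes p: "simple_path p" and card: "k \<le> card {v\<in>set p. E (last p) v}" and k: "3 \<le> k"
  shows "\<exists>c. set c \<subseteq> set p \<and> theta k c"
proof -
  have sp: "successively E p" "distinct p" using p by (auto simp: simple_path_def)
  define n where "n = length p - 1"
  define I where "I = {i. i < length p \<and> E (last p) (p ! i)}"
  have fin: "finite I" by (simp add: I_def)
  have "{v\<in>set p. E (last p) v} = (\<lambda>i. p ! i) ` I" by (auto simp: I_def in_set_conv_nth)
  then have cI: "k \<le> card I" using card card_image_le[OF fin, of "\<lambda>i. p ! i"] by simp
  then have "I \<noteq> {}" using k by auto
  then have ne: "I \<noteq> {}" "p \<noteq> []" by (auto simp: I_def)
  have lp: "last p = p ! n" "length p = Suc n" using ne by (auto simp: n_def last_conv_nth)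
  have par: "even i \<noteq> even n" if "i \<in> I" for i
    using that col[of "last p" "p ! i"] col_nth[OF sp(1), of i] col_nth[OF sp(1), of n] lp
    by (auto simp: I_def)
  define i where "i = Min I"
  have iI: "i \<in> I" and imin: "j \<in> I \<Longrightarrow> i \<le> j" for j using fin ne by (auto simp: i_def)
  have bound: "j < n" if "j \<in> I" for j
    using par[OF that] that lp by (cases "j = n") (auto simp: I_def)
  have "(\<lambda>j. (j - i) div 2) ` I \<subseteq> {..<(n + 1 - i) div 2}"
  proof safe
    fix j assume j: "j \<in> I"
    have "even (j - i)" "i \<le> j" "j < n" "even (n + 1 - i)"
      using par[OF j] par[OF iI] imin[OF j] bound[OF j] bound[OF iI] by auto
    then show "(j - i) div 2 < (n + 1 - i) div 2" by presburger
  qed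
  then have "card ((\<lambda>j. (j - i) div 2) ` I) \<le> (n + 1 - i) div 2"
    using card_mono[of "{..<(n + 1 - i) div 2}"] by fastforce
  moreover have "inj_on (\<lambda>j. (j - i) div 2) I"
  proof (rule inj_onI)
    fix j l assume j: "j \<in> I" and l: "l \<in> I" and eq: "(j - i) div 2 = (l - i) div 2"
    have "even (j - i)" "even (l - i)" "i \<le> j" "i \<le> l"
      using par[OF j] par[OF iI] par[OF l] imin[OF j] imin[OF l] by auto
    moreover from this have "j - i = l - i" using eq by (metis dvd_mult_div_cancel)
    ultimately show "j = l" by linarith
  qed
  ultimately have len: "2 * k \<le> length p - i" using cI lp by (simp add: card_image)
  have "card {i, n - 1} \<le> 2" by (simp add: card_insert_le_m1)
  then have "\<not> I \<subseteq> {i, n - 1}" using cI k card_mono[of "{i, n - 1}" I] by auto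
  then obtain j where j: "j \<in> I" "j \<noteq> i" "j \<noteq> n - 1" by auto
  then have "i < j" "j + 2 < length p" using imin[OF j(1)] bound[OF j(1)] lp by auto
  then have "theta k (drop i p)"
    using theta_drop[OF p] j iI len by (auto simp: I_def)
  then show ?thesis using set_drop_subset[of i p] by blast
qed

text \<open>All neighbours of the end of a longest path lie on the path.\<close>

lemma theta_of_min_degree:
  assumes S: "finite S" "S \<noteq> {}" and deg: "\<And>v. v \<in> S \<Longrightarrow> k \<le> card {w\<in>S. E v w}" and k: "3 \<le> k"
  shows "\<exists>c. set c \<subseteq> S \<and> theta k c"
proof -
  let ?P = "\<lambda>p. simple_path p \<and> set p \<subseteq> S \<and> p \<noteq> []"
  obtain v where "v \<in> S" using S by auto
  then have ex: "?P [v]" by simp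
  have bd: "length p < Suc (card S)" if "?P p" for p
    using that S distinct_card[of p] card_mono[of S "set p"] by (auto simp: simple_path_def)
  obtain p where p: "?P p" and max: "\<And>q. ?P q \<Longrightarrow> length q \<le> length p"
    using ex_has_greatest_nat[of ?P, OF ex, of length "Suc (card S)"] bd by (metis less_imp_le)
  have "{w\<in>S. E (last p) w} \<subseteq> {w\<in>set p. E (last p) w}"
  proof safe
    fix w assume w: "w \<in> S" "E (last p) w"
    show "w \<in> set p"
    proof (rule ccontr)
      assume "w \<notin> set p"
      then have "?P (p @ [w])" using p w by (simp add: simple_path_append)
      then show False using max[of "p @ [w]"] by simp
    qed
  qed
  then have "card {w\<in>S. E (last p) w} \<le> card {w\<in>set p. E (last p) w}"
    by (intro card_mono) auto
  moreover have "k \<le> card {w\<in>S. E (last p) w}" using p by (intro deg) auto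
  ultimately show ?thesis using theta_of_fan[of p k] p k by fastforce
qed

lemma theta_of_dense:
  assumes fin: "finite S" "finite T" and gt: "k * (card S + card T) < card (edges E S T)" and k: "3 \<le> k"
  shows "\<exists>c. set c \<subseteq> S \<union> T \<and> theta k c"
proof -
  obtain S' T' where ST: "S' \<subseteq> S" "T' \<subseteq> T" "S' \<noteq> {}" "T' \<noteq> {}" "\<forall>x\<in>S'. k < card {y\<in>T'. E x y}"
      "\<forall>y\<in>T'. k < card {x\<in>S'. E x y}"
    using edges_core[OF fin, of k k E] gt by (auto simp: distrib_left)
  have finU: "finite (S' \<union> T')" using ST fin finite_subset by blast
  have "k \<le> card {w\<in>S' \<union> T'. E v w}" if "v \<in> S' \<union> T'" for v
  proof -
    have "{x\<in>S'. E x v} = {x\<in>S'. E v x}" using sym_iff[of _ v] by simp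
    then have "card {y\<in>T'. E v y} \<le> card {w\<in>S' \<union> T'. E v w}" "card {x\<in>S'. E x v} \<le> card {w\<in>S' \<union> T'. E v w}"
      using finU by (auto intro!: card_mono)
    moreover have "k < card {y\<in>T'. E v y} \<or> k < card {x\<in>S'. E x v}"
      using ST(5,6) that by blast
    ultimately show ?thesis by linarith
  qed
  then obtain c where "set c \<subseteq> S' \<union> T'" "theta k c"
    using theta_of_min_degree[OF finU _ _ k] ST(3) by blast
  then show ?thesis using ST(1,2) by blast
qed

end

section \<open>Paths of prescribed length in theta graphs\<close>

lemma periodic_mult:
  fixes g :: "int \<Rightarrow> bool" and p n :: int
  assumes "\<And>i. g (i + p) = g i"
  shows "g (i + n * p) = g i"
proof -
  have up: "g (i + int n * p) = g i" for i n
  proof (induction n)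
    case (Suc n)
    have "g (i + int (Suc n) * p) = g ((i + int n * p) + p)" by (simp add: algebra_simps)
    then show ?case using assms Suc by simp
  qed simp
  show ?thesis
  proof (cases "n \<ge> 0")
    case True
    then show ?thesis using up[of i "nat n"] by simp
  next
    case False
    then show ?thesis using up[of "i + n * p" "nat (- n)"] by simp
  qed
qed

lemma periodic_const:
  fixes g :: "int \<Rightarrow> bool" and p a :: int
  assumes per: "\<And>i. g (i + p) = g i" and p: "1 \<le> p"
    and step: "\<And>i. a \<le> i \<Longrightarrow> i < a + p \<Longrightarrow> g i = g (i + 1)"
  shows "g i = g j"
proof -
  have "g i = g a" for i
  proof -
    have "g (a + int n) = g a" if "int n \<le> p" for n
      using that
    proof (induction n)
      case (Suc n)
      then show ?case using step[of "a + int n"] by (simp add: algebra_simps)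
    qed simp
    moreover have "0 \<le> (i - a) mod p" "(i - a) mod p \<le> p"
      using p by (auto intro: order_less_imp_le)
    ultimately have "g (a + (i - a) mod p) = g a" by (metis int_nat_eq)
    moreover have "i = (a + (i - a) mod p) + ((i - a) div p) * p"
      using div_mult_mod_eq[of "i - a" p] by linarith
    ultimately show ?thesis using periodic_mult[of g p] per by metis
  qed
  then show ?thesis by metis
qed

text \<open>
  Here \<open>g i\<close> records whether vertex \<open>2 i\<close> of a cycle of length \<open>2 M\<close> with chord from \<open>0\<close> to
  \<open>2 r + 1\<close> lies in a given set. The hypotheses are what it means that no path of length \<open>2 l\<close>
  separates two even vertices: along the cycle, and across the chord with either direction for
  each of the two arms.
\<close>
lemma two_colouring_of_chorded_cycle:
  fixes g :: "int \<Rightarrow> bool" and M l r :: int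
  assumes l: "1 \<le> l" "l < M" and r: "1 \<le> r" "r \<le> M - 2"
    and M: "\<And>i. g (i + M) = g i" and L: "\<And>i. g (i + l) = g i"
    and mp: "\<And>a. r + l < M \<Longrightarrow> 0 \<le> a \<Longrightarrow> a < l \<Longrightarrow> g (- a) = g (r + l - a)"
    and pm: "\<And>a. l \<le> r \<Longrightarrow> 0 \<le> a \<Longrightarrow> a < l \<Longrightarrow> g a = g (r + 1 - l + a)"
    and pp: "\<And>a. 0 \<le> a \<Longrightarrow> a \<le> r \<Longrightarrow> a < l \<Longrightarrow> l + r + 1 - M \<le> a \<Longrightarrow> g a = g (r + l - a)"
    and mm: "\<And>a. 0 \<le> a \<Longrightarrow> a \<le> M - r - 1 \<Longrightarrow> a < l \<Longrightarrow> l - r \<le> a \<Longrightarrow> g (- a) = g (r + 1 - l + a)"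
  shows "g i = g j"
proof -
  have L': "g (i + n * l) = g i" for i n using periodic_mult[of g l] L by blast
  have M': "g (i + n * M) = g i" for i n using periodic_mult[of g M] M by blast
  have Lm: "g (i - l) = g i" for i using L'[of i "-1"] by simp
  \<comment> \<open>The paths \<open>pp\<close> at \<open>a\<close> and \<open>mm\<close> at
    \<open>l - a\<close> start at points that differ by \<open>l\<close>, hence are coloured alike;
    their other ends are, modulo \<open>l\<close>, the consecutive integers \<open>r - a\<close> and
    \<open>r - a + 1\<close>.\<close>
  have both: "g (r - a) = g (r - a + 1)"
    if a: "1 \<le> a" "l + r + 1 - M \<le> a" "a \<le> r" "a < l" for a
  proof -
    have "g a = g (r + l - a)" using pp[of a] a by simp
    also have "\<dots> = g (r - a)" using L[of "r - a"] by (simp add: algebra_simps)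
    finally have 1: "g a = g (r - a)" .
    have "g (- (l - a)) = g (r + 1 - l + (l - a))" using mm[of "l - a"] a by simp
    then have "g (a - l) = g (r - a + 1)" by (simp add: algebra_simps)
    then show ?thesis using 1 Lm[of a] by simp
  qed
  \<comment> \<open>As soon as the admissible values of \<open>a\<close> in \<open>both\<close> fill
    a whole period \<open>p\<close>, the colouring is constant.\<close>
  have down: ?thesis if p: "1 \<le> p" "\<And>i. g (i + p) = g i" and c: "1 \<le> c" "l + r + 1 - M \<le> c" "c + p - 1 \<le> r" "c + p - 1 < l" for p c
  proof (rule periodic_const[where g = g and p = p and a = "r - (c + p - 1)", OF p(2) p(1)])
    fix i assume "r - (c + p - 1) \<le> i" "i < r - (c + p - 1) + p"
    then show "g i = g (i + 1)" using both[of "r - i"] c by simp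
  qed
  \<comment> \<open>By the period \<open>l\<close>, a shift has to be checked only on one window of
    \<open>l\<close> consecutive integers.\<close>
  have red: "g (i + n) = g i" if n: "\<And>a. 0 \<le> a \<Longrightarrow> a < l \<Longrightarrow> g (a + b) = g (a + b + n)" for i n b
  proof -
    define a where "a = (i - b) mod l"
    have a: "0 \<le> a" "a < l" using l by (auto simp: a_def)
    have e: "i = (a + b) + ((i - b) div l) * l"
      unfolding a_def using div_mult_mod_eq[of "i - b" l] by linarith
    have "g i = g (a + b)" using e L' by metis
    moreover have "i + n = (a + b + n) + ((i - b) div l) * l" using e by linarith
    then have "g (i + n) = g (a + b + n)" using L' by metis
    ultimately show ?thesis using n[OF a] by simp
  qed
  have mp': "g (i + r) = g i" if "r + l < M" for i
  proof (rule red[where b = "1 - l"])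
    fix a assume a: "0 \<le> a" "a < l"
    have "g (- (l - 1 - a)) = g (r + l - (l - 1 - a))" using mp[of "l - 1 - a"] that a by simp
    moreover have "g (r + l - (l - 1 - a)) = g (r + l - (l - 1 - a) - l)" using Lm by simp
    ultimately show "g (a + (1 - l)) = g (a + (1 - l) + r)" by (simp add: algebra_simps)
  qed
  have pm': "g (i + (r + 1)) = g i" if "l \<le> r" for i
  proof (rule red[where b = 0])
    fix a assume a: "0 \<le> a" "a < l"
    then have "g a = g (r + 1 - l + a)" using pm[of a] that by simp
    then show "g (a + 0) = g (a + 0 + (r + 1))" using Lm[of "r + 1 + a"] by (simp add: algebra_simps)
  qed
  \<comment> \<open>In the first case \<open>r\<close> and \<open>r + 1\<close> are both periods,
    hence so is 1. In the others a period just fits the window of \<open>both\<close>: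
    \<open>r\<close>, then \<open>M - l\<close>, then \<open>M - r - 1\<close>.\<close>
  consider "r + l < M" "l \<le> r" | "r + l < M" "r < l" | "r + l \<ge> M" "r < l" | "r + l \<ge> M" "l \<le> r"
    by linarith
  then show ?thesis
  proof cases
    case 1
    have s: "g (i + 1) = g i" for i
      using mp'[OF 1(1), of "i + 1"] pm'[OF 1(2), of i] by (simp add: algebra_simps)
    show ?thesis by (rule periodic_const[where g = g and p = 1 and a = 0]) (rule s s[symmetric] order_refl)+
  next
    case 2
    show ?thesis by (rule down[of r 1]) (use 2 r mp' in auto)
  next
    case 3
    have p: "g (i + (M - l)) = g i" for i using M[of "i - l"] Lm[of i] by (simp add: algebra_simps)
    show ?thesis by (rule down[OF _ p, of "l + r + 1 - M"]) (use 3 l r in auto)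
  next
    case 4
    have p: "g (i + (M - r - 1)) = g i" for i
      using M[of i] pm'[OF 4(2), of "i + (M - r - 1)"] by (simp add: algebra_simps)
    show ?thesis by (rule down[OF _ p, of "l + r + 1 - M"]) (use 4 l r in auto)
  qed
qed

section \<open>Chorded cycles indexed by the integers\<close>

lemma successively_upto: "successively (\<lambda>i j. j = i + 1) [a..b]"
proof (induction a b rule: upto.induct)
  case (1 a b)
  then show ?case
    by (cases "a + 1 \<le> b"; cases "a \<le> b") (auto simp: upto.simps[of a b] upto.simps[of "a + 1" b])
qed

lemma hd_upto: "a \<le> b \<Longrightarrow> hd [a..b] = a"
  by (simp add: upto.simps)

lemma last_upto: "a \<le> b \<Longrightarrow> last [a..b] = b"
  using upto_rec2[of a b] by simp

context bip_adj
begin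

text \<open>Indices range over all integers and are read modulo \<open>2 * M\<close>, so that arms
  passing the origin need no special treatment. A path is simple because its two arms lie in one
  interval with fewer than \<open>2 * M + 1\<close> indices, on which \<open>f\<close> is
  injective.\<close>

lemma chorded_cycle_paths:
  fixes f :: "int \<Rightarrow> 'a" and M l r :: int
  assumes l: "1 \<le> l" "l < M" and r: "1 \<le> r" "r \<le> M - 2"
    and inj: "\<And>i j. f i = f j \<longleftrightarrow> i mod (2 * M) = j mod (2 * M)"
    and adj: "\<And>i. E (f i) (f (i + 1))" and chord: "E (f 0) (f (2 * r + 1))"
    and np: "\<And>p. simple_path p \<Longrightarrow> set p \<subseteq> range f \<Longrightarrow> int (length p) = 2 * l + 1 \<Longrightarrow>
      \<exists>a. hd p = f (2 * a) \<Longrightarrow> hd p \<in> A \<longleftrightarrow> last p \<in> A"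
  shows "f (2 * i) \<in> A \<longleftrightarrow> f (2 * j) \<in> A"
proof -
  have inj': "inj_on f {a..b}" if "b - a < 2 * M" for a b
  proof (rule inj_onI)
    fix x y assume *: "x \<in> {a..b}" "y \<in> {a..b}" "f x = f y"
    then have "(x - y) mod (2 * M) = 0" using inj by (simp add: mod_eq_dvd_iff)
    then have "2 * M dvd x - y" by auto
    moreover have "\<bar>x - y\<bar> < 2 * M" using * that by auto
    ultimately show "x = y" using zdvd_imp_le[of "2 * M" "\<bar>x - y\<bar>"] by fastforce
  qed
  have seg: "simple_path (map f [a..b])" if "b - a < 2 * M" for a b
    unfolding simple_path_def successively_map distinct_map
    using inj'[OF that] adj by (auto intro: successively_mono[OF successively_upto])
  have segr: "simple_path (rev (map f [a..b]))" if "b - a < 2 * M" for a b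
    using seg[OF that] simple_path_rev by blast
  have hdl: "hd (map f [a..b]) = f a" "last (map f [a..b]) = f b"
     "hd (rev (map f [a..b])) = f b" "last (rev (map f [a..b])) = f a" if "a \<le> b" for a b
    using that by (simp_all add: hd_map last_map hd_rev last_rev hd_upto last_upto)
  have disj: "f ` {a..b} \<inter> f ` {c..d} = {}" if "a \<le> b" "b < c" "c \<le> d" "d - a < 2 * M" for a b c d
  proof -
    have "inj_on f ({a..b} \<union> {c..d})" using that by (intro inj_on_subset[OF inj'[of d a]]) auto
    then show ?thesis using that by (subst inj_on_image_Int[symmetric]) auto
  qed
  define g where "g i \<longleftrightarrow> f (2 * i) \<in> A" for i
  have use: "g a \<longleftrightarrow> g b" if "simple_path p" "set p \<subseteq> range f" "int (length p) = 2 * l + 1"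
    "hd p = f (2 * a)" "last p = f (2 * b)" for p a b
    using np[OF that(1-3)] that(4,5) by (auto simp: g_def)
  have ne: "[a..b] = [] \<longleftrightarrow> b < a" for a b :: int by (auto simp: upto.simps)
  have "g i = g j"
  proof (rule two_colouring_of_chorded_cycle[of l M r])
    fix i
    have "f (2 * (i + M)) = f (2 * i)" unfolding inj by (simp add: distrib_left)
    then show "g (i + M) = g i" by (simp add: g_def)
    show "g (i + l) = g i"
      using l seg[of "2 * (i + l)" "2 * i"] hdl[of "2 * i" "2 * (i + l)"]
      by (intro use[symmetric, of "map f [2 * i..2 * (i + l)]"]) (auto simp: algebra_simps)
  next
    fix a assume a: "r + l < M" "0 \<le> a" "a < l"
    show "g (- a) = g (r + l - a)"
    proof (rule use)
      \<comment> \<open>An arm with \<open>2 a\<close> edges up to the origin, the chord, and an arm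
        with \<open>2 (l - a) - 1\<close> edges. The next three paths differ only in the directions
        of the arms.\<close>
      let ?p = "map f [- 2 * a..0] @ map f [2 * r + 1..2 * (r + l - a)]"
      show "simple_path ?p" unfolding simple_path_append
        using a l r chord hdl(1)[of "2 * r + 1" "2 * (r + l - a)"] hdl(2)[of "- 2 * a" 0]
          disj[of "- 2 * a" 0 "2 * r + 1" "2 * (r + l - a)"] by (auto intro!: seg)
      show "int (length ?p) = 2 * l + 1" using a l r by simp
      show "hd ?p = f (2 * - a)" using a l r hdl(1)[of "- 2 * a" 0] by (simp add: ne hd_append)
      show "last ?p = f (2 * (r + l - a))" using a l r hdl(2)[of "2 * r + 1" "2 * (r + l - a)"] by (simp add: ne last_append)
    qed auto
  next
    fix a assume a: "l \<le> r" "0 \<le> a" "a < l"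
    show "g a = g (r + 1 - l + a)"
    proof (rule use)
      let ?p = "rev (map f [0..2 * a]) @ rev (map f [2 * (r + 1 - l + a)..2 * r + 1])"
      show "simple_path ?p" unfolding simple_path_append
        using a l r chord hdl(3)[of "2 * (r + 1 - l + a)" "2 * r + 1"] hdl(4)[of 0 "2 * a"]
          disj[of 0 "2 * a" "2 * (r + 1 - l + a)" "2 * r + 1"] by (auto intro!: segr simp del: rev_map)
      show "int (length ?p) = 2 * l + 1" using a l r by simp
      show "hd ?p = f (2 * a)" using a l r hdl(3)[of 0 "2 * a"] by (simp add: ne hd_append)
      show "last ?p = f (2 * (r + 1 - l + a))" using a l r hdl(4)[of "2 * (r + 1 - l + a)" "2 * r + 1"] by (simp add: ne last_append)
    qed auto
  next
    fix a assume a: "0 \<le> a" "a \<le> r" "a < l" "l + r + 1 - M \<le> a"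
    show "g a = g (r + l - a)"
    proof (rule use)
      let ?p = "rev (map f [0..2 * a]) @ map f [2 * r + 1..2 * (r + l - a)]"
      show "simple_path ?p" unfolding simple_path_append
        using a l r chord hdl(1)[of "2 * r + 1" "2 * (r + l - a)"] hdl(4)[of 0 "2 * a"]
          disj[of 0 "2 * a" "2 * r + 1" "2 * (r + l - a)"] by (auto intro!: segr seg)
      show "int (length ?p) = 2 * l + 1" using a l r by simp
      show "hd ?p = f (2 * a)" using a l r hdl(3)[of 0 "2 * a"] by (simp add: ne hd_append)
      show "last ?p = f (2 * (r + l - a))" using a l r hdl(2)[of "2 * r + 1" "2 * (r + l - a)"] by (simp add: ne last_append)
    qed auto
  next
    fix a assume a: "0 \<le> a" "a \<le> M - r - 1" "a < l" "l - r \<le> a"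
    show "g (- a) = g (r + 1 - l + a)"
    proof (rule use)
      let ?p = "map f [- 2 * a..0] @ rev (map f [2 * (r + 1 - l + a)..2 * r + 1])"
      show "simple_path ?p" unfolding simple_path_append
        using a l r chord hdl(3)[of "2 * (r + 1 - l + a)" "2 * r + 1"] hdl(2)[of "- 2 * a" 0]
          disj[of "- 2 * a" 0 "2 * (r + 1 - l + a)" "2 * r + 1"] by (auto intro!: segr seg)
      show "int (length ?p) = 2 * l + 1" using a l r by simp
      show "hd ?p = f (2 * - a)" using a l r hdl(1)[of "- 2 * a" 0] by (simp add: ne hd_append)
      show "last ?p = f (2 * (r + 1 - l + a))" using a l r hdl(4)[of "2 * (r + 1 - l + a)" "2 * r + 1"] by (simp add: ne last_append)
    qed auto
  qed (use l r in auto)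
  then show ?thesis by (simp add: g_def)
qed

text \<open>The chord joins the two colour classes, so one of its ends is coloured like
  \<open>y\<close>. With that end as origin, the even indices are exactly the class of
  \<open>y\<close>; without a separating path, membership in \<open>A\<close> would be constant on
  them.\<close>

lemma theta_separating_path:
  assumes th: "theta k c" and l: "1 \<le> l" "l < k"
    and y: "y \<in> set c" "y \<in> A" and y': "y' \<in> set c" "y' \<notin> A" and col_y: "col y = col y'"
  shows "\<exists>p. simple_path p \<and> set p \<subseteq> set c \<and> length p = 2 * l + 1 \<and> hd p \<in> A \<and> last p \<notin> A \<and>
    col (hd p) = col y \<and> col (last p) = col y"
proof (rule ccontr)
  assume no: "\<not> ?thesis"
  obtain j where c: "simple_path c" "2 * k \<le> length c" "E (last c) (hd c)"
    and j: "0 < j" "j + 2 < length c" "E (last c) (c ! j)"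
    using th by (auto simp: theta_def)
  have sc: "successively E c" "distinct c" using c by (auto simp: simple_path_def)
  define n where "n = length c"
  have n0: "0 < n" "c \<noteq> []" using y by (auto simp: n_def)
  have hdl: "hd c = c ! 0" "last c = c ! (n - 1)" using n0 by (auto simp: hd_conv_nth last_conv_nth n_def)
  have cn: "col (c ! i) = (col (c ! 0) = even i)" if "i < n" for i
    using col_nth[OF sc(1)] that by (simp add: n_def)
  have "col (c ! (n - 1)) \<noteq> col (c ! 0)" using col[OF c(3)] hdl by simp
  then have evn: "even n" using cn[of "n - 1"] n0 by auto
  have "col (c ! (n - 1)) \<noteq> col (c ! j)" using col[OF j(3)] hdl by simp
  then have evj: "even j" using cn[of "n - 1"] cn[of j] n0 evn j by (auto simp: n_def)
  define M where "M = int n div 2"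
  define r where "r = int j div 2"
  have M: "2 * M = int n" and r: "2 * r = int j" using evn evj by (auto simp: M_def r_def)
  have r': "1 \<le> r" "r \<le> M - 2" using j M r by (auto simp: n_def)
  have l': "1 \<le> int l" "int l < M" using l c(2) M by (auto simp: n_def)
  define h where "h i = c ! nat (i mod int n)" for i :: int
  have lt: "nat (i mod int n) < n" for i using n0 by (simp add: nat_less_iff)
  have h_inj: "h a = h b \<longleftrightarrow> a mod int n = b mod int n" for a b
    using lt[of a] lt[of b] sc(2) n0 by (auto simp: h_def nth_eq_iff_index_eq n_def eq_nat_nat_iff)
  have h_nat: "h (int a) = c ! a" if "a < n" for a using that by (simp add: h_def flip: of_nat_mod)
  have h_adj: "E (h i) (h (i + 1))" for i
  proof (cases "i mod int n = int n - 1")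
    case True
    then have "(i + 1) mod int n = 0" by (metis diff_add_cancel mod_add_left_eq mod_self)
    moreover have "nat (int n - 1) = n - 1" by linarith
    ultimately show ?thesis using True c(3) hdl by (simp add: h_def)
  next
    case False
    moreover have "i mod int n < int n" "0 \<le> i mod int n" using n0 by auto
    ultimately have s: "Suc (nat (i mod int n)) < n" "0 \<le> i mod int n" by linarith+
    have "(i + 1) mod int n = i mod int n + 1"
      using s mod_pos_pos_trivial[of "i mod int n + 1" "int n"] mod_add_left_eq[of i "int n" 1] by linarith
    then have "nat ((i + 1) mod int n) = Suc (nat (i mod int n))"
      using s by linarith
    then show ?thesis using sc(1) s by (simp add: h_def successively_conv_nth n_def)
  qed
  have h_set: "h i \<in> set c" for i using lt by (simp add: h_def n_def)
  have h_col: "col (h i) = (col (c ! 0) = even i)" for i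
  proof -
    have "even (nat (i mod int n)) = even (i mod int n)" using n0 by (simp add: even_nat_iff)
    also have "\<dots> = even i" using evn by (simp add: dvd_mod_iff)
    finally show ?thesis using cn[OF lt[of i]] by (simp add: h_def)
  qed
  \<comment> \<open>\<open>s\<close> is the index of the chord end taken as origin and
    \<open>t\<close> the orientation. Since the ends are \<open>- 1\<close> and
    \<open>j = 2 r\<close>, the other end is \<open>2 r + 1\<close> steps away, forwards from
    \<open>- 1\<close> or backwards from \<open>j\<close>.\<close>
  have main: False
    if t: "t = 1 \<or> t = - 1" and c0: "col (h s) = col y" and ch: "E (h s) (h (s + t * (2 * r + 1)))" for s t
  proof -
    define f where "f i = h (s + t * i)" for i
    have f_col: "col (f i) = (col y = even i)" for i
    proof -
      have "even (s + t * i) = (even s = even i)" using t by auto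
      moreover have "col (f i) = (col (c ! 0) = even (s + t * i))" by (simp add: f_def h_col)
      moreover have "col y = (col (c ! 0) = even s)" using c0 h_col by simp
      ultimately show ?thesis by blast
    qed
    have even_index: "\<exists>i. v = f (2 * i)" if v: "v \<in> set c" "col v = col y" for v
    proof -
      obtain a where a: "a < n" "v = c ! a" using v(1) by (auto simp: in_set_conv_nth n_def)
      then have "v = f (t * (int a - s))" using t h_nat[of a] by (auto simp: f_def)
      moreover from this have "even (t * (int a - s))" using f_col[of "t * (int a - s)"] v(2) by blast
      ultimately show ?thesis by (metis dvd_mult_div_cancel)
    qed
    have np: "hd p \<in> A \<longleftrightarrow> last p \<in> A"
      if p: "simple_path p" "set p \<subseteq> range f" "int (length p) = 2 * int l + 1" "\<exists>a. hd p = f (2 * a)" for p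
    proof -
      have len: "length p = 2 * l + 1" "p \<noteq> []" using p(3) by auto
      have sub: "set p \<subseteq> set c" using p(2) h_set by (auto simp: f_def)
      obtain a where "hd p = f (2 * a)" using p(4) by blast
      then have ch: "col (hd p) = col y" using f_col[of "2 * a"] by simp
      have "col (last p) = col (p ! 0)"
        using col_nth[of p "2 * l"] p(1) len by (simp add: simple_path_def last_conv_nth)
      then have cl: "col (last p) = col y" using ch len by (simp add: hd_conv_nth)
      have "\<not> (hd p \<in> A \<and> last p \<notin> A)" using no p(1) sub len ch cl by blast
      moreover have "\<not> (last p \<in> A \<and> hd p \<notin> A)"
      proof -
        have "simple_path (rev p)" "set (rev p) \<subseteq> set c" "length (rev p) = 2 * l + 1"
          "hd (rev p) = last p" "last (rev p) = hd p"
          using p(1) sub len by (simp_all add: simple_path_rev hd_rev last_rev)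
        then show ?thesis using no ch cl by metis
      qed
      ultimately show ?thesis by blast
    qed
    have "f (2 * i) \<in> A \<longleftrightarrow> f (2 * j) \<in> A" for i j
    proof (rule chorded_cycle_paths[OF l' r'])
      fix i j
      have "int n dvd t * (i - j) \<longleftrightarrow> int n dvd i - j" using t by (auto simp: algebra_simps dvd_diff_commute)
      then show "f i = f j \<longleftrightarrow> i mod (2 * M) = j mod (2 * M)"
        by (simp add: f_def h_inj M mod_eq_dvd_iff right_diff_distrib)
      show "E (f i) (f (i + 1))"
        using t h_adj[of "s + i"] sym[OF h_adj[of "s - i - 1"]] by (auto simp: f_def algebra_simps)
      show "E (f 0) (f (2 * r + 1))" using ch by (simp add: f_def)
    qed (rule np)
    then show False using even_index[of y] even_index[of y'] y y' col_y by metis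
  qed
  have h1: "h (- 1) = last c" "h (int j) = c ! j"
    using n0 h_nat[of j] j hdl by (auto simp: h_def n_def zmod_minus1 nat_diff_distrib)
  have col1: "col (h (- 1)) \<noteq> col (h (int j))" using h1 col[OF j(3)] by simp
  show False
  proof (cases "col (h (- 1)) = col y")
    case True
    then show ?thesis using main[of 1 "- 1"] h1 j(3) r by simp
  next
    case False
    have "E (h (int j)) (h (int j + - 1 * (2 * r + 1)))" using h1 j(3) r sym by simp
    then show ?thesis using main[of "- 1" "int j"] False col1 by blast
  qed
qed

end

section \<open>Breadth-first search\<close>

locale bfs = bip_adj +
  fixes V :: "'a set" and x :: 'a
  assumes finite_V: "finite V" and E_V: "E u v \<Longrightarrow> u \<in> V" and x_V: "x \<in> V"
begin

definition L :: "nat \<Rightarrow> 'a set" where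
  "L i = {v. (E ^^ i) x v \<and> (\<forall>j<i. \<not> (E ^^ j) x v)}"

lemma L_0: "L 0 = {x}"
  by (auto simp: L_def)

lemma L_disjoint: "v \<in> L i \<Longrightarrow> v \<in> L j \<Longrightarrow> i = j"
  unfolding L_def by (metis (mono_tags, lifting) mem_Collect_eq nat_neq_iff)

lemma L_Int: "i \<noteq> j \<Longrightarrow> L i \<inter> L j = {}"
  using L_disjoint by blast

lemma L_subset: "L i \<subseteq> V"
proof
  fix v assume "v \<in> L i"
  then have "(E ^^ i) x v" by (simp add: L_def)
  then show "v \<in> V" using x_V E_V sym by (cases i) (auto dest: sym)
qed

lemma finite_L [simp]: "finite (L i)"
  using L_subset finite_V finite_subset by blast

lemma L_col: "v \<in> L i \<Longrightarrow> col v = (col x = even i)"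
proof -
  have "(E ^^ i) x v \<Longrightarrow> col v = (col x = even i)" for v
  proof (induction i arbitrary: v)
    case (Suc i)
    then obtain u where "(E ^^ i) x u" "E u v" by auto
    then show ?case using Suc.IH[of u] col[of u v] by auto
  qed simp
  then show "v \<in> L i \<Longrightarrow> col v = (col x = even i)" by (simp add: L_def)
qed

lemma L_least:
  assumes "(E ^^ i) x v"
  shows "\<exists>j\<le>i. v \<in> L j"
proof -
  let ?j = "LEAST j. (E ^^ j) x v"
  have "(E ^^ ?j) x v" using assms by (rule LeastI)
  moreover have "\<forall>j<?j. \<not> (E ^^ j) x v" using not_less_Least by blast
  moreover have "?j \<le> i" using assms by (rule Least_le)
  ultimately show ?thesis unfolding L_def by blast
qed

lemma L_minimal: "v \<in> L i \<Longrightarrow> (E ^^ j) x v \<Longrightarrow> i \<le> j"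
  unfolding L_def by (auto simp: not_le[symmetric])

lemma L_parent:
  assumes "v \<in> L (Suc i)"
  shows "\<exists>u\<in>L i. E v u"
proof -
  obtain u where u: "(E ^^ i) x u" "E u v" using assms by (auto simp: L_def)
  obtain j where j: "j \<le> i" "u \<in> L j" using L_least[OF u(1)] by blast
  have "(E ^^ Suc j) x v" using j(2) u(2) by (auto simp: L_def)
  then have "Suc i \<le> Suc j" using assms L_minimal by blast
  then show ?thesis using j u(2) sym by auto
qed

text \<open>Distances of adjacent vertices differ by at most one, and the colouring rules out
  equality.\<close>

lemma L_nbr:
  assumes "v \<in> L i" and vw: "E v w"
  shows "w \<in> L (Suc i) \<or> (\<exists>j. i = Suc j \<and> w \<in> L j)"
proof -
  have "(E ^^ Suc i) x w" using assms by (auto simp: L_def)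
  then obtain j where j: "j \<le> Suc i" "w \<in> L j" using L_least by blast
  have "(E ^^ Suc j) x v" using j(2) sym[OF vw] by (auto simp: L_def)
  then have "i \<le> Suc j" using assms L_minimal by blast
  moreover have "i \<noteq> j" using L_col[OF assms(1)] L_col[OF j(2)] col[OF vw] by blast
  ultimately have "j = Suc i \<or> i = Suc j" using j by linarith
  then show ?thesis using j by auto
qed

definition well_placed :: "nat \<Rightarrow> 'a list \<Rightarrow> bool" where
  "well_placed i c \<longleftrightarrow> set c \<subseteq> L i \<union> L (Suc i) \<union> L (Suc (Suc i)) \<and>
     (\<forall>y\<in>set c \<inter> L (Suc i). \<exists>w\<in>L i - set c. E y w)"

text \<open>
  The tree of parents avoids the theta graph, so two of its vertices in the middle level whose
  tree paths first meet \<open>h\<close> levels up are joined by a tree path of length \<open>2 h\<close> outside of it.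
\<close>
lemma cycle_of_well_placed_theta:
  assumes th: "theta k c" and wp: "well_placed i c" and ik: "Suc i < k"
  shows "has_cycle (2 * k)"
proof -
  define Y where "Y = set c \<inter> L (Suc i)"
  \<comment> \<open>One parent function for the whole search tree, chosen on \<open>Y\<close> so
    that the first step leaves \<open>c\<close>. All later ancestors lie below level
    \<open>i\<close>, where \<open>c\<close> has no vertices.\<close>
  have "\<exists>p. \<forall>v. (\<forall>j. v \<in> L (Suc j) \<longrightarrow> E v (p v) \<and> p v \<in> L j) \<and> (v \<in> Y \<longrightarrow> p v \<notin> set c)"
  proof (intro choice allI)
    fix v
    show "\<exists>u. (\<forall>j. v \<in> L (Suc j) \<longrightarrow> E v u \<and> u \<in> L j) \<and> (v \<in> Y \<longrightarrow> u \<notin> set c)"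
    proof (cases "v \<in> Y")
      case True
      then obtain u where "E v u" "u \<in> L i - set c" using wp by (auto simp: well_placed_def Y_def)
      moreover have "j = i" if "v \<in> L (Suc j)" for j
        using L_disjoint[OF that, of "Suc i"] True by (simp add: Y_def)
      ultimately show ?thesis by blast
    next
      case False
      show ?thesis
      proof (cases "\<exists>j. v \<in> L (Suc j)")
        case True
        then obtain j where j: "v \<in> L (Suc j)" by blast
        then obtain u where "u \<in> L j" "E v u" using L_parent by blast
        moreover have "j' = j" if "v \<in> L (Suc j')" for j'
          using L_disjoint[OF that j] by simp
        ultimately show ?thesis using False by blast
      qed (use False in auto)
    qed
  qed
  then obtain par where par: "\<And>v j. v \<in> L (Suc j) \<Longrightarrow> E v (par v)" "\<And>v j. v \<in> L (Suc j) \<Longrightarrow> par v \<in> L j"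
    "\<And>v. v \<in> Y \<Longrightarrow> par v \<notin> set c" by blast
  have lev: "(par ^^ s) y \<in> L (Suc i - s)" if "y \<in> Y" "s \<le> Suc i" for y s
    using that(2)
  proof (induction s)
    case (Suc s)
    then have "(par ^^ s) y \<in> L (Suc (Suc i - Suc s))" by (simp add: Suc_diff_le)
    then show ?case using par(2) by simp
  qed (use that in \<open>auto simp: Y_def\<close>)
  have edge: "E ((par ^^ s) y) ((par ^^ Suc s) y)" if "y \<in> Y" "s \<le> i" for y s
  proof -
    have "(par ^^ s) y \<in> L (Suc (i - s))" using lev[OF that(1), of s] that(2) by (simp add: Suc_diff_le)
    then show ?thesis using par(1) by simp
  qed
  have off: "(par ^^ s) y \<notin> set c" if "y \<in> Y" "1 \<le> s" "s \<le> Suc i" for y s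
  proof (cases "s = 1")
    case False
    have l: "(par ^^ s) y \<in> L (Suc i - s)" using lev that by blast
    show ?thesis
    proof
      assume "(par ^^ s) y \<in> set c"
      then have "(par ^^ s) y \<in> L i \<or> (par ^^ s) y \<in> L (Suc i) \<or> (par ^^ s) y \<in> L (Suc (Suc i))"
        using wp by (auto simp: well_placed_def)
      then have "Suc i - s = i \<or> Suc i - s = Suc i \<or> Suc i - s = Suc (Suc i)"
        using l L_disjoint by blast
      then show False using False that by linarith
    qed
  qed (use that par(3) in auto)
  \<comment> \<open>Among the three levels only the middle one has the parity of
    \<open>Suc i\<close>, so \<open>Y\<close> is a full colour class of the cycle.\<close>
  have colY: "v \<in> Y \<longleftrightarrow> col v = (col x = even (Suc i))" if "v \<in> set c" for v
  proof -
    have "v \<in> L i \<or> v \<in> L (Suc i) \<or> v \<in> L (Suc (Suc i))" using that wp by (auto simp: well_placed_def)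
    then show ?thesis
    proof (elim disjE)
      assume "v \<in> L i"
      then show ?thesis using L_col[of v i] L_disjoint[of v i "Suc i"] by (auto simp: Y_def)
    next
      assume "v \<in> L (Suc i)"
      then show ?thesis using L_col[of v "Suc i"] that by (auto simp: Y_def)
    next
      assume "v \<in> L (Suc (Suc i))"
      then show ?thesis using L_col[of v "Suc (Suc i)"] L_disjoint[of v "Suc (Suc i)" "Suc i"] by (auto simp: Y_def)
    qed
  qed
  have c: "successively E c" "distinct c" "2 * k \<le> length c"
    using th by (auto simp: theta_def simple_path_def)
  have len4: "4 \<le> length c" using c(3) ik by linarith
  have "\<exists>y\<in>Y. \<exists>y'\<in>Y. y \<noteq> y'"
  proof -
    have lt: "0 < length c" "1 < length c" "2 < length c" "3 < length c" using len4 by linarith+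
    have k: "c ! 0 \<noteq> c ! 2" "c ! 1 \<noteq> c ! 3"
      using nth_eq_iff_index_eq[OF c(2) lt(1,3)] nth_eq_iff_index_eq[OF c(2) lt(2,4)] by linarith+
    have "col (c ! 2) = col (c ! 0)" "col (c ! 1) \<noteq> col (c ! 0)" "col (c ! 3) \<noteq> col (c ! 0)"
      using col_nth[OF c(1), of 2] col_nth[OF c(1), of 1] col_nth[OF c(1), of 3] lt by auto
    moreover have "c ! 0 \<in> set c" "c ! 1 \<in> set c" "c ! 2 \<in> set c" "c ! 3 \<in> set c" using lt by auto
    ultimately show ?thesis using k colY by metis
  qed
  then obtain y y' where yy: "y \<in> Y" "y' \<in> Y" "y \<noteq> y'" by blast
  define Q where "Q h \<longleftrightarrow> (\<forall>y\<in>Y. \<forall>y'\<in>Y. (par ^^ h) y = (par ^^ h) y')" for h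
  have "(par ^^ Suc i) v = x" if "v \<in> Y" for v using lev[OF that, of "Suc i"] L_0 by simp
  then have Qi: "Q (Suc i)" unfolding Q_def by metis
  \<comment> \<open>The height at which all branches from \<open>Y\<close> have merged; at height
    \<open>Suc i\<close> they have reached the root. By minimality the ancestors one step earlier
    still differ, and \<open>A\<close> collects the vertices sharing the ancestor of
    \<open>y0\<close> at that height.\<close>
  define h where "h = (LEAST h. Q h)"
  have Qh: "Q h" and hi: "h \<le> Suc i" using Qi LeastI Least_le unfolding h_def by metis+
  have "\<not> Q 0" using yy by (auto simp: Q_def)
  then have h0: "1 \<le> h" using Qh by (cases h) auto
  then have "\<not> Q (h - 1)" using not_less_Least[of "h - 1" Q] by (simp add: h_def)
  then obtain y0 y1 where y01: "y0 \<in> Y" "y1 \<in> Y" "(par ^^ (h - 1)) y0 \<noteq> (par ^^ (h - 1)) y1"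
    by (auto simp: Q_def)
  define A where "A = {v. (par ^^ (h - 1)) v = (par ^^ (h - 1)) y0}"
  have setY: "y0 \<in> set c" "y1 \<in> set c" using y01 by (auto simp: Y_def)
  have "1 \<le> k - h" "k - h < k" "y0 \<in> A" "y1 \<notin> A" "col y0 = col y1"
    using hi ik h0 y01 colY[OF setY(1)] colY[OF setY(2)] by (auto simp: A_def)
  then obtain p where p: "simple_path p" "set p \<subseteq> set c" "length p = 2 * (k - h) + 1"
      "hd p \<in> A" "last p \<notin> A" "col (hd p) = col y0" "col (last p) = col y0"
    using theta_separating_path[OF th, of "k - h" y0 A y1] setY by blast
  define a where "a = hd p"
  define b where "b = last p"
  have pne: "p \<noteq> []" using p(3) by auto
  then have "a \<in> set c" "b \<in> set c" using p(2) by (auto simp: a_def b_def)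
  then have ab: "a \<in> Y" "b \<in> Y"
    using colY setY y01(1) p(6,7) by (auto simp: a_def b_def)
  have ne: "(par ^^ (h - 1)) a \<noteq> (par ^^ (h - 1)) b" using p(4,5) by (auto simp: A_def a_def b_def)
  have lev_inj: "s = t" if "(par ^^ s) v = (par ^^ t) w" "v \<in> Y" "w \<in> Y" "s \<le> Suc i" "t \<le> Suc i" for s t v w
  proof -
    have "(par ^^ s) v \<in> L (Suc i - s)" "(par ^^ t) w \<in> L (Suc i - t)" using lev that(2-5) by blast+
    then have "Suc i - s = Suc i - t" using that(1) L_disjoint by metis
    then show ?thesis using that by linarith
  qed
  define up where "up v m = map (\<lambda>s. (par ^^ s) v) [1..<m]" for v and m :: nat
  have up: "simple_path (up v m)" if "v \<in> Y" "m \<le> Suc h" for v m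
    unfolding simple_path_def
  proof
    show "distinct (up v m)"
      using that hi lev_inj[of _ v _ v] by (auto simp: up_def distinct_map inj_on_def)
    show "successively E (up v m)"
      unfolding successively_conv_nth
    proof (intro allI impI)
      fix j assume "Suc j < length (up v m)"
      then show "E (up v m ! j) (up v m ! Suc j)"
        using edge[OF that(1), of "Suc j"] that hi by (simp add: up_def)
    qed
  qed
  have up_set: "set (up v m) = (\<lambda>s. (par ^^ s) v) ` {1..<m}" for v m by (simp add: up_def)
  have up_disj: "set (up v m) \<inter> set p = {}" if "v \<in> Y" "m \<le> Suc h" for v m
    using off[OF that(1)] that(2) hi p(2) by (fastforce simp: up_set)
  \<comment> \<open>Vertices of one level have equal heights, and branches that meet stay together,
    so a meeting below height \<open>h\<close> would contradict \<open>ne\<close>.\<close>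
  have up_ne: "set (up b (Suc h)) \<inter> set (up a h) = {}"
  proof (rule ccontr)
    assume "\<not> ?thesis"
    then obtain s t where st: "1 \<le> s" "s < Suc h" "1 \<le> t" "t < h" "(par ^^ s) b = (par ^^ t) a"
      by (auto simp: up_set)
    then have "s = t" using lev_inj ab hi by simp
    then have "(par ^^ (h - 1 - s)) ((par ^^ s) b) = (par ^^ (h - 1 - s)) ((par ^^ s) a)" using st by simp
    then have "(par ^^ (h - 1)) b = (par ^^ (h - 1)) a"
      using st \<open>s = t\<close> by (simp flip: funpow_add comp_apply[of "par ^^ _"])
    then show False using ne by simp
  qed
  have hb: "(par ^^ h) b = (par ^^ h) a" using Qh ab unfolding Q_def by blast
  have upb: "up b (Suc h) \<noteq> []" "hd (up b (Suc h)) = par b" "last (up b (Suc h)) = (par ^^ h) b"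
  proof -
    have "up b (Suc h) = par b # map (\<lambda>s. (par ^^ s) b) [2..<Suc h]"
      using h0 upt_conv_Cons[of 1 "Suc h"] by (simp add: up_def numeral_2_eq_2)
    then show "up b (Suc h) \<noteq> []" "hd (up b (Suc h)) = par b" by simp_all
    show "last (up b (Suc h)) = (par ^^ h) b" using h0 by (simp add: up_def)
  qed
  have upa: "hd (rev (up a h)) = (par ^^ (h - 1)) a" "last (rev (up a h)) = par a" if "up a h \<noteq> []"
    using that by (auto simp: up_def hd_rev last_rev hd_map last_map)
  have e: "E a (par a)" "E b (par b)" "E ((par ^^ (h - 1)) a) ((par ^^ h) a)"
    using edge[of a 0] edge[of b 0] edge[of a "h - 1"] ab h0 hi by auto
  \<comment> \<open>The common ancestor at height \<open>h\<close> is listed only with the branch of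
    \<open>b\<close>: the pieces have \<open>2 (k - h) + 1\<close>, \<open>h\<close> and
    \<open>h - 1\<close> vertices, together \<open>2 k\<close>.\<close>
  define cyc where "cyc = p @ up b (Suc h) @ rev (up a h)"
  have "simple_path cyc"
  proof -
    have "set p \<inter> set (up b (Suc h) @ rev (up a h)) = {}"
      using up_disj[OF ab(1), of h] up_disj[OF ab(2), of "Suc h"] by auto
    moreover have "E (last (up b (Suc h))) (hd (rev (up a h)))" if "up a h \<noteq> []"
      using upa(1)[OF that] upb(3) hb sym[OF e(3)] by simp
    moreover have "E (last p) (hd (up b (Suc h) @ rev (up a h)))"
      using upb e(2) by (simp add: b_def)
    moreover have "set (up b (Suc h)) \<inter> set (rev (up a h)) = {}" using up_ne by simp
    ultimately show ?thesis
      unfolding cyc_def simple_path_append simple_path_rev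
      using p(1) up[OF ab(1), of h] up[OF ab(2), of "Suc h"] by (metis le_SucI order_refl rev_is_Nil_conv)
  qed
  moreover have "length cyc = 2 * k" using p(3) h0 hi ik by (simp add: cyc_def up_def)
  moreover have "E (last cyc) (hd cyc)"
  proof (cases "up a h = []")
    case True
    then have "h = 1" using h0 by (simp add: up_def)
    then show ?thesis using True upb pne hb sym[OF e(1)] by (simp add: cyc_def a_def[symmetric])
  next
    case False
    then show ?thesis using upa sym[OF e(1)] pne by (simp add: cyc_def a_def[symmetric])
  qed
  ultimately show ?thesis unfolding has_cycle_def by blast
qed

end

section \<open>Theta graphs in three layers\<close>

text \<open>
  A uniformly random subset of \<open>X\<close> contains at least half of the neighbours of a given vertex with
  probability at least \<open>1 / 2\<close>, and all of them with probability at most \<open>1 / 4\<close>.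
\<close>
lemma split_neighbourhoods:
  assumes fin: "finite X" "finite U" and m: "1 \<le> m" and deg: "\<And>u. u \<in> U \<Longrightarrow> 2 * m \<le> card {x\<in>X. E u x}"
  shows "\<exists>X1\<subseteq>X. card U \<le> 4 * card {u\<in>U. m \<le> card {x\<in>X1. E u x} \<and> (\<exists>x\<in>X - X1. E u x)}"
proof (rule ccontr)
  let ?good = "\<lambda>A u. m \<le> card {x\<in>A. E u x} \<and> (\<exists>x\<in>X - A. E u x)"
  assume no: "\<not> ?thesis"
  have less: "4 * card {u\<in>U. ?good A u} < card U" if "A \<in> Pow X" for A
  proof (rule ccontr)
    assume "\<not> 4 * card {u\<in>U. ?good A u} < card U"
    then have "card U \<le> 4 * card {u\<in>U. ?good A u}" by (rule leI)
    with that no show False by blast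
  qed
  have each: "2 ^ card X \<le> 4 * card {A\<in>Pow X. ?good A u}" if u: "u \<in> U" for u
  proof -
    define N where "N = {x\<in>X. E u x}"
    have N: "N \<subseteq> X" "finite N" "2 * m \<le> card N" using fin deg[OF u] by (auto simp: N_def)
    have eq: "{x\<in>A. E u x} = N \<inter> A" if "A \<subseteq> X" for A using that by (auto simp: N_def)
    define P where "P = {A\<in>Pow X. m \<le> card (N \<inter> A)}"
    define Q where "Q = {A\<in>Pow X. N \<subseteq> A}"
    have finP: "finite P" "finite Q" using fin by (auto simp: P_def Q_def)
    \<comment> \<open>Either a set or its complement contains at least \<open>m\<close> of the
      \<open>2 m\<close> or more elements of \<open>N\<close>, so \<open>P\<close> holds at least
      half of all subsets.\<close>
    have "Pow X \<subseteq> P \<union> (\<lambda>A. X - A) ` P"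
    proof
      fix A assume A: "A \<in> Pow X"
      have "card N = card (N \<inter> A) + card (N \<inter> (X - A))"
        using N A by (subst card_Un_disjoint[symmetric]) (auto intro!: arg_cong[of _ _ card])
      then have "m \<le> card (N \<inter> A) \<or> m \<le> card (N \<inter> (X - A))" using N(3) by linarith
      then show "A \<in> P \<union> (\<lambda>A. X - A) ` P"
      proof
        assume "m \<le> card (N \<inter> (X - A))"
        then have "X - A \<in> P" by (simp add: P_def)
        moreover have "A = X - (X - A)" using A by auto
        ultimately show ?thesis by blast
      qed (use A in \<open>simp add: P_def\<close>)
    qed
    then have "card (Pow X) \<le> card P + card ((\<lambda>A. X - A) ` P)"
      using finP card_mono[of "P \<union> (\<lambda>A. X - A) ` P" "Pow X"] card_Un_le[of P "(\<lambda>A. X - A) ` P"] by simp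
    then have cP: "2 ^ card X \<le> 2 * card P"
      using card_image_le[OF finP(1), of "\<lambda>A. X - A"] fin by (simp add: card_Pow)
    \<comment> \<open>A set containing \<open>N\<close> is determined by its part outside
      \<open>N\<close>, and \<open>N\<close> has at least two elements.\<close>
    have "card Q \<le> card (Pow (X - N))"
    proof (rule card_inj_on_le)
      show "inj_on (\<lambda>A. A - N) Q" by (auto simp: inj_on_def Q_def)
    qed (use fin in \<open>auto simp: Q_def\<close>)
    also have "card (Pow (X - N)) = 2 ^ (card X - card N)"
      using fin N by (simp add: card_Pow card_Diff_subset)
    finally have "4 * card Q \<le> 2 ^ 2 * 2 ^ (card X - card N)" by simp
    also have "\<dots> \<le> 2 ^ card X"
      unfolding power_add[symmetric]
      using N(3) m card_mono[OF fin(1) N(1)] by (intro power_increasing) linarith+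
    finally have cQ: "4 * card Q \<le> 2 ^ card X" .
    have "P - Q \<subseteq> {A\<in>Pow X. ?good A u}"
    proof
      fix A assume "A \<in> P - Q"
      then have A: "A \<subseteq> X" "m \<le> card (N \<inter> A)" "\<not> N \<subseteq> A" by (auto simp: P_def Q_def)
      then have "\<exists>x\<in>X - A. E u x" unfolding N_def by blast
      then show "A \<in> {A\<in>Pow X. ?good A u}" using A eq[OF A(1)] by simp
    qed
    then have "card P - card Q \<le> card {A\<in>Pow X. ?good A u}"
      using fin diff_card_le_card_Diff[OF finP(2), of P] card_mono[of "{A\<in>Pow X. ?good A u}" "P - Q"]
      by fastforce
    then show ?thesis using cP cQ by linarith
  qed
  \<comment> \<open>Double counting of good pairs: every \<open>u\<close> is good for at least a
    quarter of the sets, whereas by \<open>less\<close> every set would be good for fewer than a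
    quarter of the vertices.\<close>
  have "(\<Sum>A\<in>Pow X. card {u\<in>U. ?good A u}) = (\<Sum>u\<in>U. card {A\<in>Pow X. ?good A u})"
    using fin by (intro sum_multicount_gen) auto
  then have "card U * 2 ^ card X \<le> 4 * (\<Sum>A\<in>Pow X. card {u\<in>U. ?good A u})"
    using sum_mono[of U "\<lambda>u. 2 ^ card X" "\<lambda>u. 4 * card {A\<in>Pow X. ?good A u}"] each
    by (simp add: sum_distrib_left)
  also have "\<dots> = (\<Sum>A\<in>Pow X. 4 * card {u\<in>U. ?good A u})" by (simp add: sum_distrib_left)
  also have "\<dots> < (\<Sum>A\<in>Pow X. card U)"
    using fin less by (intro sum_strict_mono) auto
  finally show False using fin by (simp add: card_Pow)
qed

text \<open>Serves to locate the lower-level vertices in a chain of segments: each of them opens a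
  block, and \<open>ys\<close> is the final vertex.\<close>

lemma nth_concat_blocks:
  assumes "\<And>b. b \<in> set bs \<Longrightarrow> length (f b) = c" "0 < c" "i < length bs"
  shows "(concat (map f bs) @ ys) ! (c * i) = hd (f (bs ! i))"
  using assms
proof (induction bs arbitrary: i)
  case (Cons b bs)
  have len: "length (f b) = c" using Cons.prems by simp
  then have ne: "f b \<noteq> []" using Cons.prems by auto
  show ?case
  proof (cases i)
    case 0
    then show ?thesis using len ne Cons.prems by (simp add: nth_append hd_conv_nth)
  next
    case (Suc j)
    then show ?thesis using len Cons by (simp add: nth_append)
  qed
qed simp

lemma length_concat_blocks:
  assumes "\<And>b. b \<in> set bs \<Longrightarrow> length (f b) = c"
  shows "length (concat (map f bs)) = c * length bs"
  using assms by (induction bs) auto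

section \<open>Segments in the upper two levels, chained through the lower one\<close>

context bip_adj
begin

text \<open>Greedy extension: as long as fewer than \<open>s\<close> vertices are used on a side,
  some neighbour there is still free.\<close>

lemma alternating_path:
  assumes ne: "S \<noteq> {}" and fin: "finite S" "finite T" and disj: "S \<inter> T = {}"
    and deg: "\<And>x. x \<in> S \<Longrightarrow> s \<le> card {y\<in>T. E x y}" "\<And>y. y \<in> T \<Longrightarrow> s \<le> card {x\<in>S. E x y}"
    and t: "1 \<le> t" "t \<le> s"
  shows "\<exists>p. simple_path p \<and> set p \<subseteq> S \<union> T \<and> length p = 2 * t - 1 \<and> hd p \<in> S \<and> last p \<in> S \<and>
    card (set p \<inter> S) \<le> t \<and> card (set p \<inter> T) < t"
  using t
proof (induction t rule: nat_induct_at_least)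
  case base
  obtain x where "x \<in> S" using ne by blast
  then show ?case using disj by (intro exI[of _ "[x]"]) (auto simp: Int_commute)
next
  case (Suc t)
  then obtain p where p: "simple_path p" "set p \<subseteq> S \<union> T" "length p = 2 * t - 1" "hd p \<in> S" "last p \<in> S"
    "card (set p \<inter> S) \<le> t" "card (set p \<inter> T) < t" by auto
  have pne: "p \<noteq> []" using p(3) Suc by auto
  have "\<not> {y\<in>T. E (last p) y} \<subseteq> set p \<inter> T"
    using card_mono[of "set p \<inter> T" "{y\<in>T. E (last p) y}"] deg(1)[OF p(5)] p(7) Suc.prems by auto
  then obtain y where y: "y \<in> T" "E (last p) y" "y \<notin> set p" by auto
  have "\<not> {x\<in>S. E x y} \<subseteq> set p \<inter> S"
    using card_mono[of "set p \<inter> S" "{x\<in>S. E x y}"] deg(2)[OF y(1)] p(6) Suc.prems by auto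
  then obtain x where x: "x \<in> S" "E y x" "x \<notin> set p" using sym by auto
  have xy: "x \<noteq> y" using x y disj by auto
  let ?p = "p @ [y, x]"
  have "set ?p \<inter> S = insert x (set p \<inter> S)" "set ?p \<inter> T = insert y (set p \<inter> T)" using x y disj by auto
  then have "card (set ?p \<inter> S) \<le> Suc t" "card (set ?p \<inter> T) < Suc t"
    using p(6,7) by (simp_all add: card_insert_if)
  moreover have "simple_path ?p" using p(1) x y xy by (simp add: simple_path_append simple_path_Cons)
  ultimately show ?case using p x y pne Suc by (intro exI[of _ ?p]) auto
qed

text \<open>The number of vertices is odd, so that a vertex of the lower level followed by a segment
  forms a block of exactly \<open>2 * s\<close> vertices.\<close>

definition segment :: "nat \<Rightarrow> 'a set \<Rightarrow> 'a set \<Rightarrow> 'a list \<Rightarrow> bool" where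
  "segment s U W p \<longleftrightarrow> simple_path p \<and> set p \<subseteq> U \<union> W \<and> length p = 2 * s - 1 \<and> hd p \<in> U \<and> last p \<in> U"

text \<open>Take a largest disjoint family. If it were smaller than claimed, it would cover fewer
  than \<open>card U / 2\<close> vertices; what remains of \<open>U\<close> and \<open>W\<close>
  would meet the density hypothesis, and its core would contain one more segment.\<close>

lemma disjoint_segments:
  assumes fin: "finite U" "finite W" and disj: "U \<inter> W = {}" and s: "1 \<le> s"
    and dense: "\<And>U' W'. U' \<subseteq> U \<Longrightarrow> W' \<subseteq> W \<Longrightarrow> card U \<le> 2 * card U' \<Longrightarrow> 2 * card (W - W') \<le> card U \<Longrightarrow>
      s * (card U' + card W') < card (edges E U' W')"
  shows "\<exists>F. finite F \<and> (\<forall>p\<in>F. segment s U W p) \<and> (\<forall>p\<in>F. \<forall>q\<in>F. p \<noteq> q \<longrightarrow> set p \<inter> set q = {}) \<and>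
    card U \<le> 4 * s * card F"
proof -
  let ?P = "\<lambda>F. finite F \<and> (\<forall>p\<in>F. segment s U W p) \<and> (\<forall>p\<in>F. \<forall>q\<in>F. p \<noteq> q \<longrightarrow> set p \<inter> set q = {})"
  have ne: "p \<noteq> []" if "segment s U W p" for p using that s by (auto simp: segment_def)
  have "card F \<le> card U" if "?P F" for F
  proof (rule card_inj_on_le[of hd])
    show "inj_on hd F"
    proof (rule inj_onI)
      fix p q assume "p \<in> F" "q \<in> F" "hd p = hd q"
      moreover from this have "hd p \<in> set p \<inter> set q"
        using that ne hd_in_set by (metis IntI)
      ultimately show "p = q" using that by blast
    qed
    show "hd ` F \<subseteq> U" using that by (auto simp: segment_def)
  qed (use fin in auto)
  then have bd: "\<forall>F. ?P F \<longrightarrow> card F < Suc (card U)" unfolding less_Suc_eq_le by blast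
  have "?P {}" by simp
  from ex_has_greatest_nat[where P = ?P and f = card, OF this bd]
  obtain F where F: "?P F" and max: "\<And>F'. ?P F' \<Longrightarrow> card F' \<le> card F" by blast
  have "card U \<le> 4 * s * card F"
  proof (rule ccontr)
    assume small: "\<not> ?thesis"
    define C where "C = (\<Union>p\<in>F. set p)"
    have finC: "finite C" using F by (auto simp: C_def)
    have "card C \<le> (\<Sum>p\<in>F. card (set p))" unfolding C_def using F by (intro card_UN_le) auto
    also have "\<dots> \<le> (\<Sum>p\<in>F. 2 * s)"
    proof (rule sum_mono)
      fix p assume "p \<in> F"
      then have "length p = 2 * s - 1" using F by (auto simp: segment_def)
      then show "card (set p) \<le> 2 * s" using card_length[of p] by linarith
    qed
    finally have cC: "2 * card C < card U" using small by (simp add: algebra_simps)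
    have "card U - card C \<le> card (U - C)" by (rule diff_card_le_card_Diff[OF finC])
    then have 1: "card U \<le> 2 * card (U - C)" using cC by linarith
    have "card (W - (W - C)) \<le> card C" using finC by (intro card_mono) auto
    then have 2: "2 * card (W - (W - C)) \<le> card U" using cC by linarith
    have "s * card (U - C) + s * card (W - C) < card (edges E (U - C) (W - C))"
      using dense[OF _ _ 1 2] by (simp add: distrib_left)
    then obtain S T where ST: "S \<subseteq> U - C" "T \<subseteq> W - C" "S \<noteq> {}" "\<forall>x\<in>S. s < card {y\<in>T. E x y}"
        "\<forall>y\<in>T. s < card {x\<in>S. E x y}"
      using edges_core[of "U - C" "W - C" s s E] fin by auto
    have finST: "finite S" "finite T" using ST fin finite_subset by blast+
    have "S \<inter> T = {}" using ST disj by blast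
    then have "\<exists>p. simple_path p \<and> set p \<subseteq> S \<union> T \<and> length p = 2 * s - 1 \<and> hd p \<in> S \<and> last p \<in> S \<and>
        card (set p \<inter> S) \<le> s \<and> card (set p \<inter> T) < s"
      using ST(4,5) s by (intro alternating_path[OF ST(3) finST, where s = s]) (simp_all add: less_imp_le)
    then obtain p where p: "simple_path p" "set p \<subseteq> S \<union> T" "length p = 2 * s - 1" "hd p \<in> S" "last p \<in> S"
      by blast
    have seg: "segment s U W p" using p ST unfolding segment_def by blast
    have dC: "set p \<inter> C = {}" using p(2) ST by blast
    have "p \<notin> F"
    proof
      assume "p \<in> F"
      then have "hd p \<in> C" using hd_in_set[OF ne[OF seg]] unfolding C_def by blast
      then show False using dC hd_in_set[OF ne[OF seg]] by blast
    qed
    moreover have "?P (insert p F)" using F seg dC by (auto simp: C_def)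
    ultimately show False using max[of "insert p F"] F by simp
  qed
  then show ?thesis using F by blast
qed

text \<open>
  A longest chain alternating between vertices of \<open>X\<close> and whole segments either returns to itself
  through \<open>k\<close> segment ends, or stops at a segment end all of whose \<open>m\<close> neighbours are on the chain;
  consecutive ones among these are at distance at least \<open>2 s\<close>.
\<close>
lemma theta_of_segments:
  fixes F :: "'a list set"
  assumes fin: "finite X" "finite F" and s: "2 \<le> s" and m: "2 \<le> m" and sm: "k \<le> s * m" and k: "3 \<le> k"
    and disj: "\<And>p q. p \<in> F \<Longrightarrow> q \<in> F \<Longrightarrow> p \<noteq> q \<Longrightarrow> set p \<inter> set q = {}"
    and seg: "\<And>p. p \<in> F \<Longrightarrow> simple_path p" "\<And>p. p \<in> F \<Longrightarrow> length p = 2 * s - 1" "\<And>p. p \<in> F \<Longrightarrow> set p \<inter> X = {}"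
    and deg: "\<And>p. p \<in> F \<Longrightarrow> m \<le> card {x\<in>X. E (hd p) x}" "\<And>p. p \<in> F \<Longrightarrow> m \<le> card {x\<in>X. E (last p) x}"
    and many: "k * card X < card F"
  shows "\<exists>c. theta k c \<and> set c \<subseteq> X \<union> (\<Union>p\<in>F. set p)"
proof -
  define en where "en p e = (if e then hd p else last p)" for p :: "'a list" and e
  \<comment> \<open>Exactly \<open>m\<close> neighbours are fixed per segment end. Every segment
    then has degree \<open>2 * m\<close> in the auxiliary graph, and a degree above
    \<open>2 * m - 1\<close> in a subgraph means that no edge was lost.\<close>
  have "\<exists>N. N \<subseteq> {x\<in>X. E u x} \<and> card N = m" if "m \<le> card {x\<in>X. E u x}" for u
    using obtain_subset_with_card_n[OF that] by metis
  then obtain N where N: "\<And>u. m \<le> card {x\<in>X. E u x} \<Longrightarrow> N u \<subseteq> {x\<in>X. E u x} \<and> card (N u) = m"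
    by metis
  have Nen: "N (en p e) \<subseteq> {x\<in>X. E (en p e) x}" "card (N (en p e)) = m" if "p \<in> F" for p e
    using N[OF deg(1)[OF that]] N[OF deg(2)[OF that]] by (auto simp: en_def)
  have pne: "p \<noteq> []" if "p \<in> F" for p using seg(2)[OF that] s by auto
  have en_set: "en p e \<in> set p" if "p \<in> F" for p e using pne[OF that] by (simp add: en_def)
  have en_inj: "p = q \<and> e = e'" if "p \<in> F" "q \<in> F" "en p e = en q e'" for p q e e'
  proof -
    have "p = q" using disj[OF that(1,2)] en_set[OF that(1), of e] en_set[OF that(2), of e'] that(3) by auto
    moreover have "hd p \<noteq> last p"
    proof -
      have "distinct p" "length p > 1" using seg(1,2)[OF that(1)] s by (auto simp: simple_path_def)
      then show ?thesis by (cases p) (auto split: if_splits)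
    qed
    ultimately show ?thesis using that(3) by (auto simp: en_def split: if_splits)
  qed
  \<comment> \<open>A bipartite multigraph between \<open>X\<close> and the segments; the flag names
    the end used. Parallel edges arise when a vertex of \<open>X\<close> is joined to both ends of
    one segment.\<close>
  define G0 where "G0 = {(x, p, e). p \<in> F \<and> x \<in> N (en p e)}"
  define sg :: "'a \<times> 'a list \<times> bool \<Rightarrow> 'a list" where "sg f = fst (snd f)" for f
  have finN: "finite (N (en p e))" if "p \<in> F" for p e
    using Nen(2)[OF that, of e] m by (intro card_ge_0_finite) simp
  have G0_seg: "{f\<in>G0. sg f = p} = (\<lambda>(e, x). (x, p, e)) ` (SIGMA e:UNIV. N (en p e))" if "p \<in> F" for p
    using that by (auto simp: G0_def sg_def image_iff)
  have card_seg: "card {f\<in>G0. sg f = p} = 2 * m" and fin_seg: "finite {f\<in>G0. sg f = p}" if "p \<in> F" for p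
  proof -
    have "card {f\<in>G0. sg f = p} = card (SIGMA e:UNIV. N (en p e))"
      unfolding G0_seg[OF that] by (rule card_image) (auto simp: inj_on_def)
    also have "\<dots> = 2 * m" using Nen(2)[OF that] finN[OF that] by simp
    finally show "card {f\<in>G0. sg f = p} = 2 * m" .
    show "finite {f\<in>G0. sg f = p}" unfolding G0_seg[OF that] using finN[OF that] by (intro finite_imageI finite_SigmaI) auto
  qed
  have G0_UN: "G0 = (\<Union>p\<in>F. {f\<in>G0. sg f = p})" by (auto simp: G0_def sg_def)
  then have finG0: "finite G0" using fin(2) fin_seg by (metis (no_types, lifting) finite_UN_I)
  have "card G0 = (\<Sum>p\<in>F. card {f\<in>G0. sg f = p})"
    by (subst G0_UN) (rule card_UN_disjoint, use fin fin_seg in auto)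
  then have cG0: "card G0 = 2 * m * card F" using card_seg by simp
  have sub: "fst ` G0 \<subseteq> X"
  proof
    fix x assume "x \<in> fst ` G0"
    then obtain p e where "p \<in> F" "x \<in> N (en p e)" by (auto simp: G0_def)
    then show "x \<in> X" using Nen(1)[of p e] by blast
  qed
  have "card (fst ` G0) \<le> card X" using sub fin by (intro card_mono)
  moreover have "card (sg ` G0) \<le> card F" using fin by (intro card_mono) (auto simp: G0_def sg_def)
  \<comment> \<open>Keeping all edges of a segment costs \<open>2 * m - 1\<close> of its
    \<open>2 * m\<close> edges. The one left over per segment pays for degrees above
    \<open>k\<close> in \<open>X\<close>, because \<open>k * card X < card F\<close>.\<close>
  ultimately have "k * card (fst ` G0) + (2 * m - 1) * card (sg ` G0) \<le> k * card X + (2 * m - 1) * card F"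
    by (intro add_mono mult_le_mono) auto
  also have "\<dots> < card F + (2 * m - 1) * card F" using many by simp
  also have "\<dots> = card G0" using cG0 m by (cases m) (auto simp: algebra_simps)
  finally obtain H where H: "H \<subseteq> G0" "H \<noteq> {}" "\<forall>x\<in>fst ` H. k < card {f\<in>H. fst f = x}"
      "\<forall>p\<in>sg ` H. 2 * m - 1 < card {f\<in>H. sg f = p}"
    using multigraph_core[OF finG0, of k fst "2 * m - 1" sg] by auto
  have finH: "finite H" using H(1) finG0 finite_subset by blast
  define X' where "X' = fst ` H"
  define F' where "F' = sg ` H"
  have X': "X' \<subseteq> X" using H(1) sub by (auto simp: X'_def)
  have F': "F' \<subseteq> F" using H(1) by (auto simp: F'_def G0_def sg_def)
  have full: "N (en p e) \<subseteq> X'" if "p \<in> F'" for p e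
  proof -
    have "2 * m \<le> card {f\<in>H. sg f = p}" using H(4) that m by (auto simp: F'_def)
    then have "{f\<in>H. sg f = p} = {f\<in>G0. sg f = p}"
      using H(1) card_seg[of p] fin_seg[of p] F' that by (intro card_seteq) auto
    moreover have "(x, p, e) \<in> {f\<in>G0. sg f = p}" if "x \<in> N (en p e)" for x
      using that \<open>p \<in> F'\<close> F' by (auto simp: G0_def sg_def)
    ultimately have "(x, p, e) \<in> H" if "x \<in> N (en p e)" for x using that by blast
    then show ?thesis unfolding X'_def by force
  qed
  \<comment> \<open>A chain may traverse a segment in either direction.\<close>
  define T where "T = F' \<union> rev ` F'"
  have T: "\<exists>p\<in>F'. \<exists>e. set q = set p \<and> hd q = en p e \<and> last q = en p (\<not> e)" if "q \<in> T" for q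
  proof -
    from that consider "q \<in> F'" | p where "p \<in> F'" "q = rev p" unfolding T_def by blast
    then show ?thesis
    proof cases
      case 1
      then show ?thesis by (intro bexI[of _ q] exI[of _ True]) (auto simp: en_def)
    next
      case 2
      then show ?thesis by (intro bexI[of _ p] exI[of _ False]) (auto simp: en_def hd_rev last_rev)
    qed
  qed
  have T_path: "simple_path q" "length q = 2 * s - 1" "set q \<inter> X = {}" "set q \<subseteq> (\<Union>p\<in>F. set p)" if "q \<in> T" for q
  proof -
    from that obtain p where p: "p \<in> F" "q = p \<or> q = rev p" using F' unfolding T_def by blast
    then have "set q = set p" by auto
    then show "set q \<inter> X = {}" "set q \<subseteq> (\<Union>p\<in>F. set p)" using seg(3)[OF p(1)] p(1) by auto
    show "simple_path q" "length q = 2 * s - 1"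
      using p(2) seg(1,2)[OF p(1)] by (auto simp: simple_path_rev)
  qed
  define flat where "flat bs z = concat (map (\<lambda>(x, p). x # p) bs) @ [z]" for bs :: "('a \<times> 'a list) list" and z
  define P where "P c \<longleftrightarrow> set (fst c) \<subseteq> X' \<times> T \<and> snd c \<in> X' \<and> simple_path (flat (fst c) (snd c))" for c
  have flat_set: "set (flat bs z) \<subseteq> X \<union> (\<Union>p\<in>F. set p)" if "P (bs, z)" for bs z
  proof -
    have "x \<in> X" "set q \<subseteq> (\<Union>p\<in>F. set p)" if "(x, q) \<in> set bs" for x q
      using that \<open>P (bs, z)\<close> X' T_path(4) unfolding P_def by auto
    moreover have "z \<in> X" using that X' by (auto simp: P_def)
    ultimately show ?thesis unfolding flat_def by fastforce
  qed
  have flat_len: "length (flat bs z) = 2 * s * length bs + 1" if "P (bs, z)" for bs z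
  proof -
    have "length ((\<lambda>(x, p). x # p) b) = 2 * s" if "b \<in> set bs" for b
      using that \<open>P (bs, z)\<close> T_path(2) s by (auto simp: P_def)
    then show ?thesis unfolding flat_def using length_concat_blocks[of bs "\<lambda>(x, p). x # p"] by simp
  qed
  have flat_nth: "flat bs z ! (2 * s * i) = fst ((bs @ [(z, [])]) ! i)" if "P (bs, z)" "i \<le> length bs" for bs z i
  proof -
    have len: "length ((\<lambda>(x, p). x # p) b) = 2 * s" if "b \<in> set bs" for b
      using that \<open>P (bs, z)\<close> T_path(2) s by (auto simp: P_def)
    show ?thesis
    proof (cases "i = length bs")
      case True
      then show ?thesis
        using length_concat_blocks[of bs "\<lambda>(x, p). x # p" "2 * s"] len by (simp add: flat_def nth_append)
    next
      case False
      then have "i < length bs" using that by simp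
      then show ?thesis
        using nth_concat_blocks[of bs "\<lambda>(x, p). x # p" "2 * s" i "[z]"] len s
        by (simp add: flat_def nth_append split: prod.split)
    qed
  qed
  let ?B = "X \<union> (\<Union>p\<in>F. set p)"
  have finB: "finite ?B" using fin by simp
  have bd: "\<forall>c. P c \<longrightarrow> length (fst c) < Suc (card ?B)"
  proof (intro allI impI)
    fix c assume c: "P c"
    obtain bs z where bz: "c = (bs, z)" by force
    have "length (flat bs z) \<le> card ?B"
      using c flat_set[of bs z] finB distinct_card[of "flat bs z"] card_mono[OF finB, of "set (flat bs z)"]
      by (simp add: bz P_def simple_path_def)
    moreover have "1 * length bs \<le> 2 * s * length bs" using s by (intro mult_le_mono1) simp
    moreover have "length (flat bs z) = 2 * s * length bs + 1" using flat_len c bz by blast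
    ultimately have "length bs < Suc (card ?B)" by linarith
    then show "length (fst c) < Suc (card ?B)" by (simp add: bz)
  qed
  obtain z0 where "z0 \<in> X'" using H(2) by (auto simp: X'_def)
  then have "P ([], z0)" by (simp add: P_def flat_def)
  from ex_has_greatest_nat[where P = P and f = "\<lambda>c. length (fst c)", OF this bd]
  obtain bs z where max0: "P (bs, z)" "\<And>c. P c \<Longrightarrow> length (fst c) \<le> length bs" by fastforce
  define p0 where "p0 = flat bs z"
  define r where "r = length bs"
  have p0: "simple_path p0" "z \<in> X'" "set bs \<subseteq> X' \<times> T" "set p0 \<subseteq> ?B" "length p0 = 2 * s * r + 1"
    using max0(1) flat_set flat_len by (auto simp: P_def p0_def r_def)
  have z: "last p0 = z" "p0 \<noteq> []" by (simp_all add: p0_def flat_def)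
  have p0_X: "v = z \<or> (\<exists>q. (v, q) \<in> set bs)" if "v \<in> set p0" "v \<in> X" for v
  proof -
    have "v \<notin> set q" if "(x, q) \<in> set bs" for x q
      using that p0(3) T_path(3) \<open>v \<in> X\<close> by blast
    then show ?thesis using that(1) by (auto simp: p0_def flat_def)
  qed
  have H_mem: "p \<in> F'" "p \<in> F" "x \<in> N (en p e)" "E x (en p e)" if "(x, p, e) \<in> H" for x p e
  proof -
    show "p \<in> F'" using that unfolding F'_def sg_def by force
    then show "p \<in> F" using F' by blast
    show x: "x \<in> N (en p e)" using that H(1) by (auto simp: G0_def)
    show "E x (en p e)" using x Nen(1)[OF \<open>p \<in> F\<close>, of e] sym by blast
  qed
  show ?thesis
  proof (cases "\<exists>p e. (z, p, e) \<in> H \<and> set p \<inter> set p0 = {}")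
    case False
    let ?D = "{f\<in>H. fst f = z}"
    \<comment> \<open>Segments are disjoint and a chain contains them whole, so a segment that meets
      the chain has both ends on it. Hence more than \<open>k\<close> neighbours of \<open>z\<close>
      lie on the chain.\<close>
    have on: "en p e \<in> {v\<in>set p0. E (last p0) v}" if pe: "(z, p, e) \<in> H" for p e
    proof -
      obtain v where v: "v \<in> set p" "v \<in> set p0" using False pe by blast
      then have "v \<notin> X" using seg(3) H_mem[OF pe] by blast
      then obtain x q where q: "(x, q) \<in> set bs" "v \<in> set q"
        using v(2) p0(2,3) X' by (fastforce simp: p0_def flat_def)
      obtain p' where p': "p' \<in> F'" "set q = set p'" using T[of q] q(1) p0(3) by blast
      have "p' = p" using disj[of p' p] p' F' H_mem[OF pe] q v by blast
      then have "en p e \<in> set q" using en_set[OF H_mem(2)[OF pe]] p' by blast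
      then have "en p e \<in> set p0" using q(1) by (force simp: p0_def flat_def)
      then show ?thesis using H_mem(4)[OF pe] z by simp
    qed
    have "card ?D \<le> card {v\<in>set p0. E (last p0) v}"
    proof (rule card_inj_on_le)
      show "inj_on (\<lambda>f. en (sg f) (snd (snd f))) ?D"
      proof (rule inj_onI)
        fix f g assume f: "f \<in> ?D" and g: "g \<in> ?D" and eq: "en (sg f) (snd (snd f)) = en (sg g) (snd (snd g))"
        obtain p e where f': "f = (z, p, e)" "(z, p, e) \<in> H" using f by (cases f) auto
        obtain p' e' where g': "g = (z, p', e')" "(z, p', e') \<in> H" using g by (cases g) auto
        have "en p e = en p' e'" using eq by (simp add: f'(1) g'(1) sg_def)
        then show "f = g" using en_inj[OF H_mem(2)[OF f'(2)] H_mem(2)[OF g'(2)]] by (simp add: f'(1) g'(1))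
      qed
      show "(\<lambda>f. en (sg f) (snd (snd f))) ` ?D \<subseteq> {v\<in>set p0. E (last p0) v}"
        using on by (auto simp: sg_def)
    qed simp
    moreover have "k < card ?D" using H(3) p0(2) unfolding X'_def by blast
    ultimately obtain c where "theta k c" "set c \<subseteq> set p0" using theta_of_fan[OF p0(1) _ k] by (meson less_imp_le order_trans)
    then show ?thesis using p0(4) by blast
  next
    case True
    then obtain p e where pe: "(z, p, e) \<in> H" "set p \<inter> set p0 = {}" by blast
    define q where "q = (if e then p else rev p)"
    have q: "q \<in> T" "set q = set p" "hd q = en p e" "last q = en p (\<not> e)"
      using H_mem(1)[OF pe(1)] by (auto simp: q_def T_def en_def hd_rev last_rev)
    have qne: "q \<noteq> []" using T_path(2)[OF q(1)] s by auto
    define N' where "N' = N (last q)"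
    have N': "N' \<subseteq> X'" "card N' = m" "\<And>x. x \<in> N' \<Longrightarrow> E (last q) x"
      using full[OF H_mem(1)[OF pe(1)], of "\<not> e"] Nen[OF H_mem(2)[OF pe(1)], of "\<not> e"] q(4) by (auto simp: N'_def)
    have path: "simple_path (p0 @ q)"
      unfolding simple_path_append using p0(1) T_path(1)[OF q(1)] pe(2) q(2,3) H_mem(4)[OF pe(1)] z by auto
    \<comment> \<open>A neighbour off the chain would prolong it by the block of \<open>z\<close>
      and \<open>q\<close>; by \<open>full\<close> it belongs to \<open>X'\<close>, as a chain
      requires.\<close>
    have on: "x \<in> set p0" if "x \<in> N'" for x
    proof (rule ccontr)
      assume "x \<notin> set p0"
      moreover have "x \<notin> set q" using T_path(3)[OF q(1)] N'(1) X' that by blast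
      ultimately have "simple_path ((p0 @ q) @ [x])"
        unfolding simple_path_append[of "p0 @ q"] using path N'(3)[OF that] qne by simp
      moreover have "flat (bs @ [(z, q)]) x = (p0 @ q) @ [x]" by (simp add: flat_def p0_def)
      ultimately have "P (bs @ [(z, q)], x)"
        using p0(2,3) q(1) N'(1) that by (auto simp: P_def)
      then show False using max0(2) by fastforce
    qed
    \<comment> \<open>Indices of the blocks opened by a neighbour of the last vertex. From the first
      of at least \<open>m\<close> such blocks to the end there are at least
      \<open>2 * s * m \<ge> 2 * k\<close> vertices.\<close>
    define I where "I = {i. i \<le> r \<and> E (last q) (p0 ! (2 * s * i))}"
    have finI: "finite I" by (simp add: I_def)
    have "N' \<subseteq> (\<lambda>i. p0 ! (2 * s * i)) ` I"
    proof
      fix x assume x: "x \<in> N'"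
      have "x = z \<or> (\<exists>q. (x, q) \<in> set bs)" using p0_X on[OF x] x N'(1) X' by blast
      then have "\<exists>y. (x, y) \<in> set (bs @ [(z, [])])" by auto
      then obtain i where "i \<le> r" "x = fst ((bs @ [(z, [])]) ! i)"
        unfolding in_set_conv_nth r_def by (auto simp: less_Suc_eq_le)
      then have "i \<le> r" "x = p0 ! (2 * s * i)" using flat_nth[OF max0(1)] by (auto simp: p0_def r_def)
      then show "x \<in> (\<lambda>i. p0 ! (2 * s * i)) ` I" using N'(3)[OF x] by (auto simp: I_def)
    qed
    then have cI: "m \<le> card I" using N'(2) finI surj_card_le by metis
    then have "I \<noteq> {}" using m by auto
    define a where "a = Min I"
    have a: "a \<in> I" "\<And>i. i \<in> I \<Longrightarrow> a \<le> i" using finI \<open>I \<noteq> {}\<close> by (auto simp: a_def)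
    have "I \<subseteq> {a..r}" using a(2) by (auto simp: I_def)
    then have ar: "m \<le> Suc r - a" using cI card_mono[of "{a..r}" I] by simp
    have "\<not> I \<subseteq> {a}" using cI m card_mono[of "{a}" I] by auto
    then obtain b where b: "b \<in> I" "a < b" using a(2) by (metis antisym_conv2 singletonI subsetI)
    have len: "length (p0 @ q) = 2 * s * Suc r" using p0(5) T_path(2)[OF q(1)] s by simp
    have nth: "(p0 @ q) ! (2 * s * i) = p0 ! (2 * s * i)" if "i \<in> I" for i
    proof -
      have "2 * s * i \<le> 2 * s * r" using that by (intro mult_le_mono) (auto simp: I_def)
      then have "2 * s * i < length p0" unfolding p0(5) by linarith
      then show ?thesis by (simp only: nth_append if_True)
    qed
    have lst: "last (p0 @ q) = last q" using qne by simp
    have "theta k (drop (2 * s * a) (p0 @ q))"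
    proof (rule theta_drop[OF path, where j = "2 * s * b"])
      show "2 * s * a < 2 * s * b" using b(2) s by simp
      have "2 * s * b \<le> 2 * s * r" using b(1) by (intro mult_le_mono) (auto simp: I_def)
      then show "2 * s * b + 2 < length (p0 @ q)" unfolding len mult_Suc_right using s by linarith
      show "E (last (p0 @ q)) ((p0 @ q) ! (2 * s * a))" "E (last (p0 @ q)) ((p0 @ q) ! (2 * s * b))"
        using a(1) b(1) lst nth[of a] nth[of b] by (auto simp: I_def)
      have "2 * k \<le> 2 * s * m" using sm by simp
      also have "\<dots> \<le> 2 * s * (Suc r - a)" using ar by (intro mult_le_mono) auto
      also have "\<dots> = length (p0 @ q) - 2 * s * a" unfolding len by (rule diff_mult_distrib2)
      finally show "2 * k \<le> length (p0 @ q) - 2 * s * a" .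
    qed
    moreover have "set (p0 @ q) \<subseteq> ?B" using p0(4) T_path(4)[OF q(1)] unfolding set_append by blast
    ultimately show ?thesis using set_drop_subset[of "2 * s * a" "p0 @ q"] by blast
  qed
qed

text \<open>Only the part \<open>X1\<close> of \<open>X\<close> may enter the theta graph, and the
  segments start and end in \<open>U1\<close>, whose vertices all have a neighbour in
  \<open>X - X1\<close>. This neighbour is off the theta graph and gives the last clause of the
  conclusion.\<close>

lemma trilayer_theta:
  fixes d :: real
  assumes fin: "finite X" "finite U" "finite W" and XUW: "X \<inter> (U \<union> W) = {}" and UW: "U \<inter> W = {}"
    and k: "4 \<le> k" and m: "2 \<le> m" "m \<le> 2 * k" and d: "10 * real k \<le> d"
    and bdeg: "\<And>u. u \<in> U \<Longrightarrow> 2 * m \<le> card {x\<in>X. E u x}"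
    and fwd: "\<And>u. u \<in> U \<Longrightarrow> 2 * d \<le> real (card {w\<in>W. E u w})"
    and sparse: "\<And>S T. S \<subseteq> U \<Longrightarrow> T \<subseteq> W \<Longrightarrow> card (edges E S T) \<le> k * (card S + card T)"
    and big: "60 * real k * real (card W) \<le> d * real m * real (card U)"
    and large: "16 * k * (k + 2) * card X < card U"
  shows "\<exists>c. theta k c \<and> set c \<subseteq> X \<union> U \<union> W \<and> (\<forall>y\<in>set c \<inter> U. \<exists>x\<in>X - set c. E y x)"
proof -
  \<comment> \<open>Large enough for \<open>s * m \<ge> k\<close> and \<open>s \<ge> 2\<close>,
    while \<open>m \<le> 2 * k\<close> still keeps \<open>s * m\<close> below
    \<open>5 * k\<close>.\<close>
  define s where "s = k div m + 2"
  have "k < m * (k div m) + m" using m mod_less_divisor[of m k] mult_div_mod_eq[of m k] by linarith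
  then have sm: "k \<le> s * m" unfolding s_def by (simp add: algebra_simps)
  have "s * m \<le> 5 * k" using m(2) div_times_less_eq_dividend[of k m] unfolding s_def distrib_right by linarith
  then have sm5: "real s * real m \<le> 5 * real k" by (metis of_nat_le_iff of_nat_mult of_nat_numeral)
  have sk: "s \<le> k + 2" by (simp add: s_def)
  obtain X1 where X1: "X1 \<subseteq> X" "card U \<le> 4 * card {u\<in>U. m \<le> card {x\<in>X1. E u x} \<and> (\<exists>x\<in>X - X1. E u x)}"
    using split_neighbourhoods[OF fin(1,2) _ bdeg] m by force
  define U1 where "U1 = {u\<in>U. m \<le> card {x\<in>X1. E u x} \<and> (\<exists>x\<in>X - X1. E u x)}"
  have U1: "U1 \<subseteq> U" "card U \<le> 4 * card U1" using X1(2) by (auto simp: U1_def)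
  have finU1: "finite U1" using U1 fin finite_subset by blast
  have "\<exists>F. finite F \<and> (\<forall>p\<in>F. segment s U1 W p) \<and> (\<forall>p\<in>F. \<forall>q\<in>F. p \<noteq> q \<longrightarrow> set p \<inter> set q = {}) \<and>
    card U1 \<le> 4 * s * card F"
  proof (rule disjoint_segments[OF finU1 fin(3)])
    fix U' W' assume U': "U' \<subseteq> U1" and W': "W' \<subseteq> W" and c1: "card U1 \<le> 2 * card U'" and c2: "2 * card (W - W') \<le> card U1"
    have finU': "finite U'" "finite W'" using U' W' finU1 fin finite_subset by blast+
    have pos: "0 < card U'" using large U1(2) c1 by linarith
    \<comment> \<open>At least \<open>2 d |U'|\<close> edges go up from \<open>U'\<close>, and by
      \<open>sparse\<close> at most \<open>2 k |U'|\<close> of them miss \<open>W'\<close>. On the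
      other side \<open>s |W'| \<le> (2 / 3) d |U'|\<close> by \<open>big\<close>, where
      \<open>|U| \<le> 8 |U'|\<close>: a factor 4 from the splitting and 2 from
      \<open>c1\<close>.\<close>
    have "2 * d * card U' = (\<Sum>u\<in>U'. 2 * d)" by simp
    also have "\<dots> \<le> (\<Sum>u\<in>U'. real (card {w\<in>W. E u w}))" using U' U1 by (intro sum_mono fwd) auto
    also have "\<dots> = real (card (edges E U' W))" using card_edges_left[of U' W E] finU' fin by simp
    also have "edges E U' W = edges E U' W' \<union> edges E U' (W - W')" using W' by (auto simp: edges_def)
    also have "real (card \<dots>) \<le> real (card (edges E U' W')) + real (card (edges E U' (W - W')))"
      using card_Un_le by (metis of_nat_add of_nat_mono)
    also have "card (edges E U' (W - W')) \<le> k * (card U' + card (W - W'))"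
      using U' U1 by (intro sparse) auto
    also have "\<dots> \<le> k * (card U' + card U')" using c1 c2 by (intro mult_le_mono2) linarith
    finally have 1: "2 * d * card U' \<le> real (card (edges E U' W')) + 2 * real k * card U'"
      by (simp add: algebra_simps)
    have cW: "card W' \<le> card W" using W' fin card_mono by blast
    have "12 * (real s * real m) * card W' \<le> 12 * (5 * real k) * card W"
    proof (rule mult_mono)
      show "12 * (real s * real m) \<le> 12 * (5 * real k)" using sm5 by linarith
    qed (use cW in auto)
    also have "\<dots> \<le> d * m * card U" using big by simp
    also have "\<dots> \<le> d * m * (8 * card U')"
      using U1(2) c1 d by (intro mult_left_mono) auto
    finally have "m * (12 * (real s * card W')) \<le> m * (8 * d * card U')" by (simp add: algebra_simps)
    then have 2: "12 * (real s * card W') \<le> 8 * d * card U'" using m by simp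
    have 3: "real s * card U' \<le> (real k + 2) * card U'" using sk by (intro mult_right_mono) auto
    have "0 < (2 * d - 2 * k - (k + 2) - 8/12 * d) * card U'"
      using d k pos by (intro mult_pos_pos) auto
    then have "real s * card U' + real s * card W' < card (edges E U' W')"
      using 1 2 3 by (simp add: algebra_simps)
    then have "real (s * (card U' + card W')) < card (edges E U' W')" by (simp add: algebra_simps)
    then show "s * (card U' + card W') < card (edges E U' W')" by (simp only: of_nat_less_iff)
  next
    show "U1 \<inter> W = {}" using U1(1) UW by blast
    show "1 \<le> s" by (simp add: s_def)
  qed
  then obtain F where F: "finite F" "\<forall>p\<in>F. segment s U1 W p"
    "\<forall>p\<in>F. \<forall>q\<in>F. p \<noteq> q \<longrightarrow> set p \<inter> set q = {}" "card U1 \<le> 4 * s * card F"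
    by (elim exE conjE)
  \<comment> \<open>The 16 in \<open>large\<close> is 4 from the splitting times 4 from the disjoint
    segments; \<open>k + 2\<close> bounds \<open>s\<close>.\<close>
  have "16 * (k + 2) * (k * card X) < 4 * (4 * s * card F)"
    using large U1(2) F(4) by (simp add: algebra_simps)
  also have "\<dots> \<le> 16 * (k + 2) * card F" using mult_le_mono1[OF sk, of "16 * card F"] by (simp add: algebra_simps)
  finally have "k * card X < card F" by simp
  moreover have "k * card X1 \<le> k * card X" using X1(1) fin by (intro mult_le_mono2 card_mono)
  ultimately have many: "k * card X1 < card F" by linarith
  have sub: "(\<Union>p\<in>F. set p) \<subseteq> U1 \<union> W" using F(2) unfolding segment_def by blast
  have ends: "hd p \<in> U1" "last p \<in> U1" if "p \<in> F" for p using F(2) that by (auto simp: segment_def)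
  have "\<exists>c. theta k c \<and> set c \<subseteq> X1 \<union> (\<Union>p\<in>F. set p)"
  proof (rule theta_of_segments[OF _ F(1), where s = s and m = m])
    show "set p \<inter> X1 = {}" if "p \<in> F" for p using that sub X1(1) XUW U1(1) by blast
    show "m \<le> card {x\<in>X1. E (hd p) x}" "m \<le> card {x\<in>X1. E (last p) x}" if "p \<in> F" for p
      using ends[OF that] by (auto simp: U1_def)
    show "finite X1" using X1(1) fin(1) finite_subset by blast
    show "simple_path p" "length p = 2 * s - 1" if "p \<in> F" for p using F(2) that by (auto simp: segment_def)
    show "set p \<inter> set q = {}" if "p \<in> F" "q \<in> F" "p \<noteq> q" for p q using F(3) that by blast
  qed (use sm m k many in \<open>auto simp: s_def\<close>)
  then obtain c where c: "theta k c" "set c \<subseteq> X1 \<union> (\<Union>p\<in>F. set p)" by blast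
  have "\<exists>x\<in>X - set c. E y x" if "y \<in> set c" "y \<in> U" for y
  proof -
    have "y \<in> U1" using that c(2) sub X1(1) XUW UW by blast
    then obtain x where "x \<in> X - X1" "E y x" by (auto simp: U1_def)
    moreover from this have "x \<notin> set c" using c(2) sub XUW U1(1) by blast
    ultimately show ?thesis by blast
  qed
  then show ?thesis using c sub X1(1) U1(1) by (intro exI[of _ c]) blast
qed

end

section \<open>Dyadic classes and their logarithmic cost\<close>

lemma ln2_lower: "7 / 12 \<le> ln (2::real)"
proof -
  have inv: "1 - inverse y \<le> ln y" if "0 < y" for y :: real
    using ln_le_minus_one[of "inverse y"] that by (simp add: ln_inverse)
  \<comment> \<open>Applying \<open>inv\<close> directly to 2 would yield only 1/2; factoring first
    gives \<open>1 / 4 + 1 / 3\<close>, enough for \<open>2 * (ln 2)^2 \<ge> 3 / 5\<close> later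
    on.\<close>
  have "ln (2::real) = ln (4 / 3 * (3 / 2))" by simp
  also have "\<dots> = ln (4 / 3) + ln (3 / 2)" by (rule ln_mult_pos) auto
  finally show ?thesis using inv[of "4 / 3"] inv[of "3 / 2"] by simp
qed

text \<open>The values fall into classes with indices from 1 up to some \<open>j\<close> with
  \<open>2 ^ j < k\<close>. There are at most \<open>ln k / ln 2\<close> of them, and some class
  carries at least the average share of the sum.\<close>

lemma dyadic_pigeonhole:
  fixes B :: "'a \<Rightarrow> nat" and M :: real
  assumes fin: "finite U" and B: "\<And>u. u \<in> U \<Longrightarrow> 8 \<le> B u \<and> B u < 4 * k"
    and sum: "M \<le> (\<Sum>u\<in>U. real (B u))" "0 < M"
  shows "\<exists>j\<ge>1. 2 ^ j < k \<and> M * ln 2 \<le> ln k * (\<Sum>u | u \<in> U \<and> 4 * 2 ^ j \<le> B u \<and> B u < 8 * 2 ^ j. real (B u))"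
proof (rule ccontr)
  assume no: "\<not> ?thesis"
  define J where "J = {j. 1 \<le> j \<and> 2 ^ j < k}"
  define C where "C j = {u\<in>U. 4 * 2 ^ j \<le> B u \<and> B u < 8 * 2 ^ j}" for j
  have lt: "j < k" if "2 ^ j < k" for j using that less_exp[of j] by linarith
  then have finJ: "finite J" by (intro finite_subset[of J "{..<k}"]) (auto simp: J_def)
  have cover: "\<exists>j\<in>J. u \<in> C j" if u: "u \<in> U" for u
  proof -
    have B': "8 \<le> B u" "B u < 4 * k" using B[OF u] by auto
    then have "1 \<le> B u div 4" by linarith
    from ex_power_ivl1[OF order_refl this]
    obtain j where j: "2 ^ j \<le> B u div 4" "B u div 4 < 2 ^ (j + 1)" by blast
    have "j \<noteq> 0" using j(2) B' by (intro notI) simp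
    moreover have "2 ^ j < k" using j(1) B' by linarith
    moreover have "4 * 2 ^ j \<le> B u" "B u < 8 * 2 ^ j" using j by auto
    ultimately have "j \<in> J" "u \<in> C j" using u by (auto simp: J_def C_def)
    then show ?thesis by blast
  qed
  have "M \<le> (\<Sum>u\<in>U. real (B u))" by (rule sum(1))
  also have "\<dots> \<le> (\<Sum>u\<in>U. \<Sum>j\<in>J. if u \<in> C j then real (B u) else 0)"
  proof (rule sum_mono)
    fix u assume "u \<in> U"
    then obtain j where j: "j \<in> J" "u \<in> C j" using cover by blast
    then have "real (B u) = (\<Sum>j\<in>{j}. if u \<in> C j then real (B u) else 0)" by simp
    also have "\<dots> \<le> (\<Sum>j\<in>J. if u \<in> C j then real (B u) else 0)"
      using j(1) finJ by (intro sum_mono2) auto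
    finally show "real (B u) \<le> (\<Sum>j\<in>J. if u \<in> C j then real (B u) else 0)" .
  qed
  also have "\<dots> = (\<Sum>j\<in>J. \<Sum>u\<in>U. if u \<in> C j then real (B u) else 0)" by (rule sum.swap)
  also have "\<dots> = (\<Sum>j\<in>J. \<Sum>u\<in>C j. real (B u))"
  proof (rule sum.cong)
    fix j
    have "U \<inter> C j = C j" by (auto simp: C_def)
    then show "(\<Sum>u\<in>U. if u \<in> C j then real (B u) else 0) = (\<Sum>u\<in>C j. real (B u))"
      using sum.inter_restrict[OF fin, of "\<lambda>u. real (B u)" "C j"] by simp
  qed simp
  finally have M: "M \<le> (\<Sum>j\<in>J. \<Sum>u\<in>C j. real (B u))" .
  then have "J \<noteq> {}" using sum(2) by auto
  then have Jn: "Max J \<in> J" using finJ by simp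
  have "J \<subseteq> {1..Max J}" using finJ by (auto simp: J_def)
  then have "card J \<le> Max J" using card_mono[of "{1..Max J}" J] by simp
  then have "2 ^ card J \<le> (2::nat) ^ Max J" by simp
  also have "\<dots> < k" using Jn by (simp add: J_def)
  finally have "real (2 ^ card J) \<le> real k" by (simp only: of_nat_le_iff)
  moreover have "0 < k" using Jn by (auto simp: J_def intro: gr0I)
  ultimately have "ln (2 ^ card J) \<le> ln (real k)" by (subst ln_le_cancel_iff) auto
  then have cJ: "card J * ln 2 \<le> ln k" by (simp add: ln_realpow)
  have lnk: "0 < ln (real k)"
    using cJ \<open>J \<noteq> {}\<close> finJ by (smt (verit) card_gt_0_iff ln_gt_zero mult_pos_pos of_nat_0_less_iff)
  have "ln k * M \<le> (\<Sum>j\<in>J. ln k * (\<Sum>u\<in>C j. real (B u)))"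
    using M lnk by (simp flip: sum_distrib_left)
  also have "\<dots> < (\<Sum>j\<in>J. M * ln 2)"
    using no finJ \<open>J \<noteq> {}\<close> by (intro sum_strict_mono) (auto simp: J_def C_def not_le)
  also have "\<dots> = M * (card J * ln 2)" by simp
  also have "\<dots> \<le> M * ln k" using cJ sum(2) by (intro mult_left_mono) auto
  finally show False by (simp add: mult.commute)
qed

section \<open>Growth of the levels\<close>

context bfs
begin

text \<open>For a theta graph within these two levels every parent of a middle vertex is free, since
  it lies one level further down. Between the root and level 1 there is only a star.\<close>

lemma sparse_levels:
  assumes no: "\<not> has_cycle (2 * k)" and k: "3 \<le> k" and i: "i < k" and ST: "S \<subseteq> L i" "T \<subseteq> L (Suc i)"
  shows "card (edges E S T) \<le> k * (card S + card T)"
proof (cases i)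
  case 0
  have fin: "finite S" "finite T" using ST finite_L finite_subset by blast+
  have "card S \<le> 1" using card_mono[OF _ ST(1)] 0 by (simp add: L_0)
  have "card (edges E S T) \<le> card (S \<times> T)" using fin by (intro card_mono) (auto simp: edges_def)
  also have "\<dots> \<le> 1 * card T" using \<open>card S \<le> 1\<close> unfolding card_cartesian_product by (rule mult_le_mono1)
  also have "\<dots> \<le> k * (card S + card T)" using k by (intro mult_le_mono) auto
  finally show ?thesis .
next
  case (Suc j)
  have fin: "finite S" "finite T" using ST finite_L finite_subset by blast+
  show ?thesis
  proof (rule ccontr)
    assume "\<not> ?thesis"
    then have "k * (card S + card T) < card (edges E S T)" by simp
    from theta_of_dense[OF fin this k] obtain c where c: "set c \<subseteq> S \<union> T" "theta k c" by blast
    have "well_placed j c"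
      unfolding well_placed_def
    proof (intro conjI ballI)
      show "set c \<subseteq> L j \<union> L (Suc j) \<union> L (Suc (Suc j))" using c(1) ST Suc by blast
      fix y assume "y \<in> set c \<inter> L (Suc j)"
      then obtain w where "w \<in> L j" "E y w" using L_parent by blast
      moreover have "w \<notin> set c"
      proof
        assume "w \<in> set c"
        then have "w \<in> L (Suc j) \<or> w \<in> L (Suc (Suc j))" using c(1) ST Suc by blast
        then show False
          using L_disjoint[OF \<open>w \<in> L j\<close>, of "Suc j"] L_disjoint[OF \<open>w \<in> L j\<close>, of "Suc (Suc j)"] by auto
      qed
      ultimately show "\<exists>w\<in>L j - set c. E y w" by blast
    qed
    then show False using cycle_of_well_placed_theta[OF c(2)] no i Suc by blast
  qed
qed

context
  fixes k :: nat and d :: real and D :: nat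
  assumes k: "4 \<le> k" and d: "256 * real k ^ 4 \<le> d" and D: "2 * d + 5 * (real k)\<^sup>2 \<le> real D"
    and degree: "\<And>v. v \<in> V \<Longrightarrow> D \<le> card {w. E v w}"
    and no_cycle: "\<not> has_cycle (2 * k)"
begin

lemma d_large: "10 * real k \<le> d" "1 \<le> d"
proof -
  have "10 * real k \<le> 256 * real k ^ 4"
    using k power_increasing[of 1 4 "real k"] by (simp add: mult_mono)
  then show "10 * real k \<le> d" using d by linarith
  then show "1 \<le> d" using k by linarith
qed

lemma degree_split:
  assumes "v \<in> L (Suc i)"
  shows "D \<le> card {w\<in>L i. E v w} + card {w\<in>L (Suc (Suc i)). E v w}"
proof -
  have "{w. E v w} \<subseteq> {w\<in>L i. E v w} \<union> {w\<in>L (Suc (Suc i)). E v w}"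
    using L_nbr[OF assms] by auto
  then have "card {w. E v w} \<le> card ({w\<in>L i. E v w} \<union> {w\<in>L (Suc (Suc i)). E v w})"
    by (intro card_mono) auto
  also have "\<dots> \<le> card {w\<in>L i. E v w} + card {w\<in>L (Suc (Suc i)). E v w}" by (rule card_Un_le)
  finally show ?thesis using degree assms L_subset by fastforce
qed

lemma edges_level_bound: "i < k \<Longrightarrow> card (edges E (L i) (L (Suc i))) \<le> k * (card (L i) + card (L (Suc i)))"
  using sparse_levels[OF no_cycle] k by simp

text \<open>The second bound at one level makes that level no larger than the next, so by sparsity
  few edges of the next level go down. The others give the first bound one step later, and sparsity
  turns their number into a lower bound on the following level.\<close>

lemma level_growth:
  assumes "i < k"
  shows "2 * d * card (L i) \<le> card (edges E (L i) (L (Suc i))) \<and> d * card (L i) \<le> k * card (L (Suc i))"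
  using assms
proof (induction i)
  case 0
  have "{w. E x w} \<subseteq> {w\<in>L 1. E x w}" using L_nbr[of x 0] by (auto simp: L_0)
  then have "card {w. E x w} \<le> card {w\<in>L 1. E x w}" by (intro card_mono) auto
  then have "D \<le> card {w\<in>L 1. E x w}" using degree[OF x_V] by linarith
  moreover have "card (edges E (L 0) (L 1)) = card {w\<in>L 1. E x w}"
    by (simp add: card_edges_left L_0)
  ultimately have 1: "D \<le> card (edges E (L 0) (L 1))" by simp
  have "2 * d \<le> D" using D by (smt (verit) zero_le_power2)
  then have 2: "2 * d * card (L 0) \<le> card (edges E (L 0) (L 1))" using 1 by (simp add: L_0)
  have "real (card (edges E (L 0) (L 1))) \<le> real (k * (card (L 0) + card (L 1)))"
    using edges_level_bound[of 0] k unfolding of_nat_le_iff One_nat_def by simp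
  then have "2 * d \<le> k * (1 + card (L 1))" using 2 by (simp add: L_0 algebra_simps)
  then have "d \<le> k * card (L 1)" using d_large by (simp add: algebra_simps)
  then show ?case using 2 by (simp add: L_0)
next
  case (Suc i)
  let ?a = "real (card (L i))" and ?b = "real (card (L (Suc i)))" and ?c = "real (card (L (Suc (Suc i))))"
  have IH: "d * ?a \<le> k * ?b" using Suc by simp
  have "k * ?a \<le> d * ?a" using d_large by (intro mult_right_mono) auto
  then have "k * ?a \<le> k * ?b" using IH by linarith
  then have ab: "?a \<le> ?b" using k mult_le_cancel_left_pos[of "real k" ?a ?b] by simp
  have "D * card (L (Suc i)) = (\<Sum>v\<in>L (Suc i). D)" by simp
  also have "\<dots> \<le> (\<Sum>v\<in>L (Suc i). card {w\<in>L i. E w v} + card {w\<in>L (Suc (Suc i)). E v w})"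
    using degree_split sym_iff by (intro sum_mono) simp
  also have "\<dots> = card (edges E (L i) (L (Suc i))) + card (edges E (L (Suc i)) (L (Suc (Suc i))))"
    by (simp add: sum.distrib card_edges_left[of "L (Suc i)"] card_edges_right[of _ "L (Suc i)"])
  also have "card (edges E (L i) (L (Suc i))) \<le> k * (card (L i) + card (L (Suc i)))"
    using edges_level_bound Suc.prems by simp
  finally have "real (D * card (L (Suc i))) \<le> real (k * (card (L i) + card (L (Suc i))) + card (edges E (L (Suc i)) (L (Suc (Suc i)))))"
    by (simp only: of_nat_le_iff)
  then have 1: "D * ?b \<le> k * (?a + ?b) + card (edges E (L (Suc i)) (L (Suc (Suc i))))" by simp
  have "k * (?a + ?b) \<le> k * (?b + ?b)" using ab by (intro mult_left_mono) auto
  moreover have "(2 * d + 2 * k) * ?b \<le> D * ?b"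
  proof (rule mult_right_mono)
    have "2 * real k \<le> 5 * (real k)\<^sup>2" using k by (simp add: power2_eq_square)
    then show "2 * d + 2 * k \<le> D" using D by linarith
  qed simp
  ultimately have 2: "2 * d * ?b \<le> card (edges E (L (Suc i)) (L (Suc (Suc i))))"
    using 1 by (simp add: algebra_simps)
  have "real (card (edges E (L (Suc i)) (L (Suc (Suc i))))) \<le> real (k * (card (L (Suc i)) + card (L (Suc (Suc i)))))"
    using edges_level_bound Suc.prems by (simp only: of_nat_le_iff)
  then have "2 * d * ?b \<le> k * ?b + k * ?c" using 2 by (simp add: algebra_simps)
  moreover have "k * ?b \<le> d * ?b" using d_large by (intro mult_right_mono) auto
  ultimately have "d * ?b \<le> k * ?c" by linarith
  then show ?case using 2 by simp
qed

lemma L_nonempty: "i \<le> k \<Longrightarrow> 0 < card (L i)"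
proof (induction i)
  case (Suc i)
  have "0 < d * card (L i)" using Suc d_large by (intro mult_pos_pos) auto
  also have "\<dots> \<le> k * card (L (Suc i))" using level_growth[of i] Suc.prems by simp
  finally show ?case by (simp add: zero_less_mult_iff)
qed (simp add: L_0)

lemma two_level_growth:
  assumes i: "Suc i < k"
  shows "d\<^sup>2 * card (L i) \<le> 400 * real k * (ln k)\<^sup>2 * card (L (Suc (Suc i)))"
proof (rule ccontr)
  assume no: "\<not> ?thesis"
  define a where "a = real (card (L i))"
  define b where "b = real (card (L (Suc i)))"
  define c where "c = real (card (L (Suc (Suc i))))"
  define l where "l = ln (real k)"
  have small: "400 * real k * l\<^sup>2 * c < d\<^sup>2 * a" using no by (simp add: a_def c_def l_def)
  have a0: "0 < a" using L_nonempty[of i] i by (simp add: a_def)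
  have "2 * ln 2 = ln (2 ^ 2 :: real)" by (subst ln_realpow) auto
  also have "\<dots> \<le> l" unfolding l_def using k by (subst ln_le_cancel_iff) auto
  finally have l2: "2 * ln 2 \<le> l" .
  then have l1: "1 \<le> l" using ln2_lower by linarith
  \<comment> \<open>The one-step growth turns the smallness of \<open>c\<close> into smallness of
    \<open>b\<close> against \<open>d * a\<close>; vertices with fewer than 8 neighbours below then
    carry a negligible share of the edges.\<close>
  have "d * (400 * l\<^sup>2 * b) \<le> 400 * real k * l\<^sup>2 * c"
    using level_growth[OF i] mult_left_mono[of "d * b" "k * c" "400 * l\<^sup>2"] by (simp add: b_def c_def algebra_simps)
  also have "\<dots> < d * (d * a)" using small by (simp add: power2_eq_square mult.assoc)
  finally have "400 * l\<^sup>2 * b < d * a" using d_large by simp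
  moreover have "400 * 1 * b \<le> 400 * l\<^sup>2 * b"
    using l1 by (intro mult_right_mono mult_left_mono) (auto simp: b_def)
  ultimately have b: "400 * b < d * a" by linarith
  define B where "B u = card {w\<in>L i. E w u}" for u
  have eB: "card (edges E (L i) S) = (\<Sum>u\<in>S. B u)" if "finite S" for S
    unfolding B_def using that by (intro card_edges_right) auto
  define lo where "lo = {u\<in>L (Suc i). B u < 8}"
  define hi where "hi = {u\<in>L (Suc i). 4 * k \<le> B u}"
  define mid where "mid = {u\<in>L (Suc i). 8 \<le> B u \<and> B u < 4 * k}"
  have fin: "finite lo" "finite hi" "finite mid" by (simp_all add: lo_def hi_def mid_def)
  have "2 * d * a \<le> (\<Sum>u\<in>L (Suc i). real (B u))"
    using level_growth[of i] i eB[of "L (Suc i)"] by (simp add: a_def)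
  also have "L (Suc i) = lo \<union> (hi \<union> mid)" by (auto simp: lo_def hi_def mid_def)
  also have "(\<Sum>u\<in>\<dots>. real (B u)) \<le> (\<Sum>u\<in>lo. real (B u)) + (\<Sum>u\<in>hi \<union> mid. real (B u))"
    using fin by (subst sum_Un) (auto intro: sum_nonneg)
  also have "(\<Sum>u\<in>hi \<union> mid. real (B u)) \<le> (\<Sum>u\<in>hi. real (B u)) + (\<Sum>u\<in>mid. real (B u))"
    using fin by (subst sum_Un) (auto intro: sum_nonneg)
  finally have total: "2 * d * a \<le> (\<Sum>u\<in>lo. real (B u)) + ((\<Sum>u\<in>hi. real (B u)) + (\<Sum>u\<in>mid. real (B u)))" by simp
  have "(\<Sum>u\<in>lo. real (B u)) \<le> (\<Sum>u\<in>lo. 8)" by (intro sum_mono) (auto simp: lo_def)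
  also have "\<dots> = 8 * real (card lo)" by simp
  also have "card lo \<le> card (L (Suc i))" by (intro card_mono) (auto simp: lo_def)
  finally have low: "(\<Sum>u\<in>lo. real (B u)) \<le> 8 * b" by (simp add: b_def)
  \<comment> \<open>The edges at \<open>hi\<close> number at least \<open>4 k |hi|\<close>, yet by
    sparsity at most \<open>k a + k |hi|\<close>; so they are at most \<open>2 k a\<close>, again a
    small share.\<close>
  have "card (edges E (L i) hi) \<le> k * (card (L i) + card hi)"
    using sparse_levels[OF no_cycle, of i "L i" hi] k i by (auto simp: hi_def)
  then have "real (\<Sum>u\<in>hi. B u) \<le> real (k * (card (L i) + card hi))" using eB[OF fin(2)] by (simp only: of_nat_le_iff)
  then have h1: "(\<Sum>u\<in>hi. real (B u)) \<le> real k * a + real k * real (card hi)" by (simp add: a_def algebra_simps)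
  have "(\<Sum>u\<in>hi. real (4 * k)) \<le> (\<Sum>u\<in>hi. real (B u))"
    by (intro sum_mono) (simp only: hi_def of_nat_le_iff mem_Collect_eq)
  then have "4 * (k * real (card hi)) \<le> (\<Sum>u\<in>hi. real (B u))" by (simp add: algebra_simps)
  then have high: "(\<Sum>u\<in>hi. real (B u)) \<le> 2 * (k * a)"
    using h1 mult_nonneg_nonneg[of "real k" a] a0 by linarith
  have "10 * (k * a) \<le> d * a" using mult_right_mono[OF d_large(1), of a] a0 by simp
  then have sum_mid: "d * a \<le> (\<Sum>u\<in>mid. real (B u))" 
    using total low high b mult_nonneg_nonneg[of d a] d_large a0 by linarith
  obtain j where j: "1 \<le> j" "2 ^ j < k"
    "d * a * ln 2 \<le> ln k * (\<Sum>u | u \<in> mid \<and> 4 * 2 ^ j \<le> B u \<and> B u < 8 * 2 ^ j. real (B u))"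
    using dyadic_pigeonhole[OF fin(3) _ sum_mid] a0 d_large by (force simp: mid_def)
  \<comment> \<open>Downward degrees in \<open>U\<close> lie between \<open>2 m\<close> and
    \<open>4 m\<close>; half of the lower bound is given up when the lower level is split.\<close>
  define m :: nat where "m = 2 * 2 ^ j"
  define U where "U = {u\<in>mid. 4 * 2 ^ j \<le> B u \<and> B u < 8 * 2 ^ j}"
  have UL: "U \<subseteq> L (Suc i)" by (auto simp: U_def mid_def)
  have finU: "finite U" using fin by (simp add: U_def)
  have m: "2 \<le> m" "m < 2 * k" using j(2) by (auto simp: m_def)
  have Bm: "2 * m \<le> B u" "B u < 4 * m" if "u \<in> U" for u using that by (auto simp: U_def m_def)
  have "(\<Sum>u\<in>U. real (B u)) \<le> (\<Sum>u\<in>U. real (4 * m))"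
    using Bm(2) by (intro sum_mono) (simp only: of_nat_le_iff less_imp_le)
  then have "l * (\<Sum>u\<in>U. real (B u)) \<le> l * (4 * real m * card U)" using l1 by (intro mult_left_mono) (auto simp: algebra_simps)
  then have U1: "d * a * ln 2 \<le> l * (4 * real m * card U)" using j(3) by (simp add: l_def U_def)
  \<comment> \<open>One logarithm in \<open>400 k l^2\<close> pays for the dyadic choice, the other
    times \<open>ln 2\<close> is at least 3/5. Thus \<open>400 / 4 = 100\<close> becomes 60.\<close>
  have big: "60 * real k * c \<le> d * real m * real (card U)"
  proof -
    have l6: "3 / 5 \<le> l * ln 2"
    proof -
      have "3 / 5 \<le> (2 * (7 / 12)) * (7 / 12 :: real)" by simp
      also have "\<dots> \<le> l * ln 2" using l2 ln2_lower by (intro mult_mono) linarith+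
      finally show ?thesis .
    qed
    have "400 * real k * l\<^sup>2 * c * ln 2 \<le> d\<^sup>2 * a * ln 2"
      using small ln2_lower by (intro mult_right_mono) auto
    also have "\<dots> = d * (d * a * ln 2)" by (simp add: power2_eq_square)
    also have "\<dots> \<le> d * (l * (4 * real m * card U))" using U1 d_large by (intro mult_left_mono) auto
    finally have "(4 * l) * (100 * real k * c * (l * ln 2)) \<le> (4 * l) * (d * m * card U)"
      by (simp add: power2_eq_square algebra_simps)
    then have "100 * real k * c * (l * ln 2) \<le> d * m * card U" using l1 by (simp add: algebra_simps)
    moreover have "100 * real k * c * (3 / 5) \<le> 100 * real k * c * (l * ln 2)"
      using l6 by (intro mult_left_mono) (auto simp: c_def)
    moreover have "100 * real k * c * (3 / 5) = 60 * real k * c" by simp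
    ultimately show ?thesis by linarith
  qed
  \<comment> \<open>With \<open>l \<le> k / 2\<close>, \<open>m < 2 k\<close> and
    \<open>ln 2 \<ge> 1 / 2\<close>, the bound \<open>U1\<close> gives
    \<open>d a / 2 \<le> 4 k^2 |U|\<close>; then \<open>d \<ge> 256 k^4\<close> yields
    \<open>|U| \<ge> 32 k^2 a\<close>.\<close>
  have large: "16 * k * (k + 2) * card (L i) < card U"
  proof -
    have "l \<le> real k * (1 / 2)"
    proof -
      have "ln (real k / 2 / 2) \<le> real k / 2 / 2 - 1" using k by (intro ln_le_minus_one) simp
      moreover have "ln (real k) = ln (real k / 2 / 2) + 2 * ln 2"
        using k ln_realpow[of "2 :: real" 2] by (simp add: ln_div)
      moreover have "ln (2 :: real) \<le> 1" using ln_le_minus_one[of "2 :: real"] by simp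
      ultimately show ?thesis using k by (simp add: l_def)
    qed
    then have "l * (4 * real m * card U) \<le> (real k * (1 / 2)) * (4 * (2 * real k) * card U)"
      using m(2) l1 by (intro mult_mono) auto
    moreover have "256 * real k ^ 4 * a * (1 / 2) \<le> d * a * ln 2"
      using d d_large a0 ln2_lower by (intro mult_mono) auto
    ultimately have "(4 * (real k)\<^sup>2) * (32 * (real k)\<^sup>2 * a) \<le> (4 * (real k)\<^sup>2) * card U"
      using U1 by (simp add: power2_eq_square power4_eq_xxxx algebra_simps)
    then have "32 * (real k)\<^sup>2 * a \<le> card U" by (rule mult_left_le_imp_le) (use k in simp)
    moreover have "16 * real k * (real k + 2) * a < 32 * (real k)\<^sup>2 * a"
      using k a0 by (intro mult_strict_right_mono) (auto simp: power2_eq_square algebra_simps)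
    moreover have "real (16 * k * (k + 2) * card (L i)) = 16 * real k * (real k + 2) * a"
      by (simp add: a_def algebra_simps)
    ultimately have "real (16 * k * (k + 2) * card (L i)) < real (card U)" by linarith
    then show ?thesis by (simp only: of_nat_less_iff)
  qed
  have "\<exists>c. theta k c \<and> set c \<subseteq> L i \<union> U \<union> L (Suc (Suc i)) \<and> (\<forall>y\<in>set c \<inter> U. \<exists>x\<in>L i - set c. E y x)"
  proof (rule trilayer_theta[where d = d and m = m])
    have "L i \<inter> L (Suc i) = {}" "L i \<inter> L (Suc (Suc i)) = {}" "L (Suc i) \<inter> L (Suc (Suc i)) = {}"
      by (rule L_Int; simp)+
    then show "L i \<inter> (U \<union> L (Suc (Suc i))) = {}" "U \<inter> L (Suc (Suc i)) = {}" using UL by blast+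
    have eqB: "B u = card {x\<in>L i. E u x}" for u unfolding B_def using sym_iff by metis
    show "2 * m \<le> card {x\<in>L i. E u x}" if "u \<in> U" for u using Bm(1)[OF that] eqB by simp
    show "2 * d \<le> real (card {w\<in>L (Suc (Suc i)). E u w})" if "u \<in> U" for u
    proof -
      \<comment> \<open>Vertices of \<open>U\<close> come from \<open>mid\<close>, so fewer than
        \<open>4 k\<close> neighbours lie below; the term \<open>5 k^2\<close> in the degree bound
        absorbs them.\<close>
      have "D \<le> B u + card {w\<in>L (Suc (Suc i)). E u w}" using degree_split that UL eqB by auto
      moreover have "real (B u) \<le> 5 * (real k)\<^sup>2"
      proof -
        have "real (B u) \<le> 4 * real k" using that by (auto simp: U_def mid_def)
        also have "\<dots> \<le> 5 * (real k)\<^sup>2" using k by (simp add: power2_eq_square)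
        finally show ?thesis .
      qed
      ultimately show ?thesis using D by linarith
    qed
    show "card (edges E S T) \<le> k * (card S + card T)" if "S \<subseteq> U" "T \<subseteq> L (Suc (Suc i))" for S T
      using sparse_levels[OF no_cycle _ i, of S T] that UL k by auto
    show "60 * real k * real (card (L (Suc (Suc i)))) \<le> d * real m * real (card U)" using big by (simp add: c_def)
    show "16 * k * (k + 2) * card (L i) < card U" by (rule large)
    show "10 * real k \<le> d" by (rule d_large(1))
    show "m \<le> 2 * k" using m(2) by simp
  qed (rule finU k m(1) finite_L)+
  then obtain th where th: "theta k th" "set th \<subseteq> L i \<union> U \<union> L (Suc (Suc i))" "\<forall>y\<in>set th \<inter> U. \<exists>x\<in>L i - set th. E y x" by blast
  have "set th \<inter> L (Suc i) \<subseteq> U"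
    using th(2) L_Int[of i "Suc i"] L_Int[of "Suc (Suc i)" "Suc i"] by auto
  then have "well_placed i th" using th(2,3) UL unfolding well_placed_def by blast
  then show False using cycle_of_well_placed_theta[OF th(1)] no_cycle i by blast
qed

end

end

lemma power_le_of_two_step_growth:
  fixes f :: "nat \<Rightarrow> real"
  assumes "0 \<le> r" "1 \<le> f 0" "r \<le> f 1" and step: "\<And>i. Suc i < k \<Longrightarrow> r\<^sup>2 * f i \<le> f (Suc (Suc i))" and "i \<le> k"
  shows "r ^ i \<le> f i"
  using \<open>i \<le> k\<close>
proof (induction i rule: less_induct)
  case (less i)
  \<comment> \<open>Even and odd indices evolve separately, each from its own initial value.\<close>
  consider "i = 0" | "i = 1" | j where "i = Suc (Suc j)"
    by (metis One_nat_def not0_implies_Suc)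
  then show ?case
  proof cases
    case 3
    then have "r\<^sup>2 * r ^ j \<le> r\<^sup>2 * f j" using less by (intro mult_left_mono) auto
    also have "\<dots> \<le> f i" using step[of j] less.prems 3 by simp
    finally show ?thesis by (simp add: 3 power2_eq_square mult.assoc)
  qed (use assms in auto)
qed

text \<open>The factor \<open>q = 20 sqrt k ln k\<close> is the square root of the loss
  \<open>400 k (ln k)^2\<close>, so \<open>d \<ge> q * r\<close> makes two steps grow by at least
  \<open>r^2\<close>. As \<open>r ^ k = n\<close>, level \<open>k\<close> would exhaust all vertices
  and leave no room for the root.\<close>

lemma (in bfs) cycle_of_min_degree:
  fixes d :: real
  assumes k: "4 \<le> k" and n: "card V = n" and d1: "20 * sqrt k * ln k * n powr (1 / k) \<le> d"
    and d2: "256 * real k ^ 4 \<le> d" and D: "2 * d + 5 * (real k)\<^sup>2 \<le> real D"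
    and degree: "\<And>v. v \<in> V \<Longrightarrow> D \<le> card {w. E v w}"
  shows "has_cycle (2 * k)"
proof (rule ccontr)
  assume no: "\<not> ?thesis"
  note ctxt = k d2 D degree no
  define r where "r = n powr (1 / k)"
  define q where "q = 20 * sqrt k * ln k"
  have n0: "0 < n" using n x_V finite_V card_gt_0_iff by blast
  have "2 * ln 2 = ln (2 ^ 2 :: real)" by (subst ln_realpow) auto
  also have "\<dots> \<le> ln k" using k by (subst ln_le_cancel_iff) auto
  finally have lnk: "1 \<le> ln k" using ln2_lower by linarith
  have "1 * 1 \<le> sqrt k * ln k" using k lnk by (intro mult_mono) auto
  then have q: "1 \<le> q" by (simp add: q_def)
  have r0: "0 < r" using n0 by (simp add: r_def)
  have qr: "q * r \<le> d" using d1 by (simp add: q_def r_def)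
  have q2: "q\<^sup>2 = 400 * real k * (ln k)\<^sup>2" using k by (simp add: q_def power_mult_distrib)
  have "r ^ k \<le> card (L k)"
  proof (rule power_le_of_two_step_growth[where f = "\<lambda>i. real (card (L i))" and k = k])
    have "1 * r \<le> q * r" using q r0 by (intro mult_right_mono) auto
    then have "r \<le> d" using qr by linarith
    moreover have "2 * d * card (L 0) \<le> card (edges E (L 0) (L (Suc 0)))"
      using level_growth[OF ctxt, of 0] k by simp
    moreover have "card (edges E (L 0) (L 1)) \<le> card (L 1)"
    proof -
      have "card (edges E (L 0) (L 1)) = card {w\<in>L 1. E x w}" by (simp add: card_edges_left L_0)
      also have "\<dots> \<le> card (L 1)" by (intro card_mono) auto
      finally show ?thesis .
    qed
    ultimately show "r \<le> card (L 1)" using r0 by (simp add: L_0)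
    show "r\<^sup>2 * card (L i) \<le> card (L (Suc (Suc i)))" if "Suc i < k" for i
    proof -
      have "q\<^sup>2 * (r\<^sup>2 * card (L i)) = (q * r)\<^sup>2 * card (L i)" by (simp add: power_mult_distrib)
      also have "\<dots> \<le> d\<^sup>2 * card (L i)" using qr q r0 by (intro mult_right_mono power_mono) auto
      also have "\<dots> \<le> q\<^sup>2 * card (L (Suc (Suc i)))"
        using two_level_growth[OF ctxt that] by (simp add: q2)
      finally show ?thesis by (rule mult_left_le_imp_le) (use q in simp)
    qed
  qed (use r0 in \<open>auto simp: L_0\<close>)
  moreover have "r ^ k = n" using n0 k by (simp add: r_def powr_realpow[symmetric] powr_powr)
  ultimately have "n \<le> card (L k)" by simp
  moreover have "card (L k \<union> L 0) \<le> n"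
    using n L_subset finite_V by (metis Un_least card_mono)
  moreover have "card (L k \<union> L 0) = card (L k) + card (L 0)"
    using L_Int[of k 0] k by (intro card_Un_disjoint) auto
  ultimately show False by (simp add: L_0)
qed

section \<open>Cycles in digraphs\<close>

lemma (in wf_digraph) awalk_of_vertices:
  assumes "xs \<noteq> []" "set xs \<subseteq> verts G" "successively (\<lambda>u v. (u, v) \<in> arcs_ends G) xs"
  shows "\<exists>p. awalk (hd xs) p (last xs) \<and> awalk_verts (hd xs) p = xs"
  using assms
proof (induction xs rule: induct_list012)
  case (2 u)
  then show ?case by (intro exI[of _ "[]"]) (simp add: awalk_def)
next
  case (3 u v xs)
  then obtain p where p: "awalk v p (last (v # xs))" "awalk_verts v p = v # xs" by auto
  obtain e where "e \<in> arcs G" "tail G e = u" "head G e = v"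
    using 3 by (auto simp: arcs_ends_def arc_to_ends_def)
  then show ?case using p by (intro exI[of _ "e # p"]) (auto simp: awalk_Cons_iff)
qed simp

text \<open>Repeating \<open>hd c\<close> at the end closes the walk; without its first entry the
  resulting vertex list is a rotation of \<open>c\<close>, hence still distinct.\<close>

lemma (in wf_digraph) cycle_of_vertices:
  assumes c: "distinct c" "successively (\<lambda>u v. (u, v) \<in> arcs_ends G) c" "(last c, hd c) \<in> arcs_ends G"
    "set c \<subseteq> verts G" "c \<noteq> []"
  shows "\<exists>p. cycle p \<and> length p = length c"
proof -
  have "hd c \<in> verts G" using c(4) hd_in_set[OF c(5)] by blast
  have hd: "hd (c @ [hd c]) = hd c" using c(5) by simp
  have "successively (\<lambda>u v. (u, v) \<in> arcs_ends G) (c @ [hd c])"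
    using c by (simp add: successively_append_iff)
  then obtain p where p: "awalk (hd c) p (hd c)" "awalk_verts (hd c) p = c @ [hd c]"
    using awalk_of_vertices[of "c @ [hd c]"] c(4,5) hd \<open>hd c \<in> verts G\<close> by auto
  have len: "length p = length c" using arg_cong[OF p(2), of length] by (simp add: length_awalk_verts)
  moreover have "distinct (tl (awalk_verts (hd c) p))"
    unfolding p(2) using c(1,5) by (cases c) auto
  ultimately show ?thesis unfolding cycle_def using p(1) c(5) by (metis length_0_conv)
qed

lemma (in nomulti_digraph) out_degree_eq_card:
  "out_degree G v = card {w. (v, w) \<in> arcs_ends G}"
proof -
  have "{w. (v, w) \<in> arcs_ends G} = head G ` out_arcs G v"
    by (auto simp: arcs_ends_def arc_to_ends_def out_arcs_def)
  moreover have "inj_on (head G) (out_arcs G v)"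
    by (intro inj_onI no_multi_arcs) (auto simp: out_arcs_def arc_to_ends_def)
  ultimately show ?thesis by (simp add: out_degree_def card_image)
qed

theorem theorem1:
  fixes k n :: nat and d :: real and G :: "('a, 'b) pre_digraph"
  assumes "k \<ge> 4" and "n > 0"
    and "d \<ge> max (20 * sqrt (real k) * ln (real k) * real n powr (1 / real k))
                  ((2 * real k) ^ (8 * k))"
    and "graph G" and "bipartite G" and "card (verts G) = n"
    and "real (min_degree G) \<ge> 2 * d + 5 * (real k)\<^sup>2"
  shows "\<exists>p. pre_digraph.cycle G p \<and> length p = 2 * k"
proof -
  interpret graph G by (rule assms(4))
  define E where "E u v \<longleftrightarrow> (u, v) \<in> arcs_ends G" for u v
  obtain A B where AB: "verts G = A \<union> B" "A \<inter> B = {}"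
    "\<forall>(u, v)\<in>arcs_ends G. (u \<in> A \<and> v \<in> B) \<or> (u \<in> B \<and> v \<in> A)"
    using assms(5) unfolding bipartite_def by (elim exE conjE)
  have ends: "(u \<in> A \<and> v \<in> B) \<or> (u \<in> B \<and> v \<in> A)" if "E u v" for u v
    using AB(3) that unfolding E_def by fast
  obtain x where "x \<in> verts G" using assms(2,6) by fastforce
  then interpret bfs E "\<lambda>v. v \<in> A" "verts G" x
  proof unfold_locales
    show "E v u" if "E u v" for u v
      using that sym_arcs unfolding E_def symmetric_def by (rule symD[rotated])
    show "(u \<in> A) \<noteq> (v \<in> A)" "u \<in> verts G" if "E u v" for u v using AB(1,2) ends[OF that] by blast+
  qed auto
  have "has_cycle (2 * k)"
  proof (rule cycle_of_min_degree[OF assms(1,6)])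
    \<comment> \<open>The left side is \<open>256 k^4\<close>, and \<open>4 k \<le> (2 k)^2\<close>
      raises it to the power of \<open>2 k\<close> in the hypothesis.\<close>
    have "(4 * real k) ^ 4 \<le> (2 * real k) ^ 8"
    proof -
      have "(2 * real k) ^ 8 = ((2 * real k)\<^sup>2) ^ 4" by (simp flip: power_mult)
      moreover have "4 * real k \<le> (2 * real k)\<^sup>2" using assms(1) by (simp add: power2_eq_square)
      ultimately show ?thesis using power_mono[of "4 * real k" "(2 * real k)\<^sup>2" 4] by simp
    qed
    also have "\<dots> \<le> (2 * real k) ^ (8 * k)" using assms(1) by (intro power_increasing) auto
    finally show "256 * real k ^ 4 \<le> d" using assms(3) by (simp add: power_mult_distrib)
    show "min_degree G \<le> card {w. E v w}" if "v \<in> verts G" for v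
      using that out_degree_eq_card[of v] unfolding min_degree_def E_def by (metis Min_le finite_imageI finite_verts imageI)
  qed (use assms(3,7) in auto)
  then obtain c where c: "distinct c" "successively E c" "length c = 2 * k" "E (last c) (hd c)"
    unfolding has_cycle_def simple_path_def by blast
  have "c \<noteq> []" using c(3) assms(1) by auto
  moreover have "set c \<subseteq> verts G"
  proof
    fix v assume "v \<in> set c"
    then obtain i where i: "i < length c" "v = c ! i" by (auto simp: in_set_conv_nth)
    show "v \<in> verts G"
    proof (cases "Suc i < length c")
      case True
      then show ?thesis using c(2) i E_V by (auto simp: successively_conv_nth)
    next
      case False
      then have "v = last c" using i by (cases c rule: rev_cases) (auto simp: nth_append)
      then show ?thesis using c(4) E_V by blast
    qed
  qed
  moreover have "successively (\<lambda>u v. (u, v) \<in> arcs_ends G) c" "(last c, hd c) \<in> arcs_ends G"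
    using c(2,4) by (simp_all add: E_def[abs_def])
  ultimately show ?thesis using cycle_of_vertices[OF c(1)] c(3) by metis
qed

end
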